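(* Let $G$ be a precompact Hausdorff abelian topological group and let $A\subset G$ be a set of nonzero elements of $G$. Then $A$ is topologically independent if and only if the topological subgroup $\langle A\rangle$ of $G$ generated by $A$ is a Tychonoff direct sum of the cyclic topological groups $\langle a\rangle$, $a\in A$.
   Context: All groups are abelian (written additively) and all topological groups are Hausdorff. A topological group is precompact if it is a topological subgroup of a compact group. For a subset $A$ of a group $G$, $\langle A\rangle$ denotes the subgroup of $G$ generated by $A$, and $\langle a\rangle=\langle\{a\}\rangle$ for $a\in G$. Topological independence: a set $A$ of nonzero elements of a topological group $G$ is topologically independent if for every neighborhood $W$ of $0_G$ there exists a neighborhood $U$ of $0_G$ such that for every finite set $B\subset A$ and every family $(z_a)_{a\in B}$ of integers, $\sum_{a\in B}z_a a\in U$ implies $z_a a\in W$ for all $a\in B$. Tychonoff direct sum: let $S_A=\bigoplus_{a\in A}\langle a\rangle$, where each $\langle a\rangle$ carries the subgroup topology inherited from $G$ and $S_A$ carries the subgroup topology inherited from the Tychonoff product $\prod_{a\in A}\langle a\rangle$. Let $\mathcal{K}_A:S_A\to G$ be the unique group homomorphism extending each inclusion map $\langle a\rangle\to G$, $a\in A$. We say that $\langle A\rangle$ is a Tychonoff direct sum of the cyclic groups $\langle a\rangle$, $a\in A$, if $\mathcal{K}_A$ is at the same time an isomorphic embedding (an injective homomorphism) and a homeomorphic embedding. *)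

theory Defs
  imports "HOL-Analysis.Analysis" "HOL-Computational_Algebra.Group_Closure"
begin

text \<open>
  A Hausdorff abelian topological group \<open>G\<close> is a type of sort
  \<open>{topological_ab_group_add, t2_space}\<close>; the subgroup generated by a set is
  \<^const>\<open>group_closure\<close> from the library.
\<close>

definition zmul :: "int \<Rightarrow> 'a::ab_group_add \<Rightarrow> 'a" where
  "zmul z a = (if 0 \<le> z then (\<Sum>i<nat z. a) else - (\<Sum>i<nat (- z). a))"

text \<open>
  \<open>G\<close> (of type \<open>'a\<close>) is isomorphic, as a topological group, to a topological subgroup of the
  compact Hausdorff abelian group \<open>'k\<close>. A definition cannot quantify over types, so the compact
  group is a parameter. When \<open>'k\<close> occurs in the hypotheses of a theorem only, it is universally
  quantified there, and the hypothesis amounts to: there is a compact group, on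
  some type, that contains a copy of \<open>G\<close>.
\<close>

definition precompact_in ::
  "'k::{topological_ab_group_add, t2_space} itself \<Rightarrow>
   'a::{topological_ab_group_add, t2_space} itself \<Rightarrow> bool" where
  "precompact_in _ _ \<longleftrightarrow>
     compact (UNIV :: 'k set) \<and>
     (\<exists>f :: 'a \<Rightarrow> 'k. (\<forall>x y. f (x + y) = f x + f y) \<and> embedding_map euclidean euclidean f)"

definition topologically_independent :: "'a::topological_ab_group_add set \<Rightarrow> bool" where
  "topologically_independent A \<longleftrightarrow>
     0 \<notin> A \<and>
     (\<forall>W. 0 \<in> interior W \<longrightarrow>
        (\<exists>U. 0 \<in> interior U \<and>
           (\<forall>B z. finite B \<and> B \<subseteq> A \<and> (\<Sum>a\<in>B. zmul (z a) a) \<in> U \<longrightarrow>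
              (\<forall>a\<in>B. zmul (z a) a \<in> W))))"

text \<open>
  The direct sum of the groups \<open>\<langle>a\<rangle>\<close>, \<open>a \<in> A\<close>. Following \<^const>\<open>product_topology\<close>, families
  indexed by \<open>A\<close> are functions that are \<^const>\<open>undefined\<close> outside \<open>A\<close>; the group operations are
  pointwise on \<open>A\<close>.
\<close>

definition direct_sum :: "'a::ab_group_add set \<Rightarrow> ('a \<Rightarrow> 'a) set" where
  "direct_sum A = {x \<in> \<Pi>\<^sub>E a\<in>A. group_closure {a}. finite {a \<in> A. x a \<noteq> 0}}"

definition direct_sum_topology :: "'a::topological_ab_group_add set \<Rightarrow> ('a \<Rightarrow> 'a) topology" where
  "direct_sum_topology A =
     subtopology (product_topology (\<lambda>a. top_of_set (group_closure {a})) A) (direct_sum A)"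

definition direct_sum_map :: "'a::ab_group_add set \<Rightarrow> ('a \<Rightarrow> 'a) \<Rightarrow> 'a" where
  "direct_sum_map A x = (\<Sum>a\<in>{a \<in> A. x a \<noteq> 0}. x a)"

definition tychonoff_direct_sum :: "'a::topological_ab_group_add set \<Rightarrow> bool" where
  "tychonoff_direct_sum A \<longleftrightarrow>
     (\<forall>x\<in>direct_sum A. \<forall>y\<in>direct_sum A.
        direct_sum_map A (\<lambda>a\<in>A. x a + y a) = direct_sum_map A x + direct_sum_map A y) \<and>
     inj_on (direct_sum_map A) (direct_sum A) \<and>
     embedding_map (direct_sum_topology A) euclidean (direct_sum_map A)"

lemma topspace_direct_sum_topology: "topspace (direct_sum_topology A) = direct_sum A"
  by (auto simp: direct_sum_topology_def direct_sum_def)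

lemma zmul_simps:
  "zmul 0 a = 0" "zmul 1 a = a" "zmul (z + w) a = zmul z a + zmul w a"
proof -
  have step: "zmul (z + 1) a = zmul z a + a" for z
  proof (cases "0 \<le> z")
    case True
    then have "nat (z + 1) = Suc (nat z)" by simp
    then show ?thesis using True by (simp add: zmul_def)
  next
    case False
    then have "nat (- z) = Suc (nat (- (z + 1)))" by simp
    then show ?thesis using False
      by (cases "z = -1") (auto simp: zmul_def)
  qed
  show z0: "zmul 0 a = 0" by (simp add: zmul_def)
  show "zmul 1 a = a" by (simp add: zmul_def)
  show "zmul (z + w) a = zmul z a + zmul w a"
  proof (induction w rule: int_induct[where k = 0])
    case base
    then show ?case by (simp add: z0)
  next
    case (step1 i)
    then show ?case using step[of "z + i"] step[of i] by (simp add: algebra_simps)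
  next
    case (step2 i)
    then show ?case using step[of "z + i - 1"] step[of "i - 1"] by (simp add: algebra_simps)
  qed
qed

lemma zmul_diff: "zmul (z - w) a = zmul z a - zmul w a"
  using zmul_simps(3)[of "z - w" w a] by simp

lemma group_closure_singleton: "group_closure {a} = range (\<lambda>z. zmul z a)"
proof (intro equalityI subsetI)
  fix x assume "x \<in> group_closure {a}"
  then show "x \<in> range (\<lambda>z. zmul z a)"
  proof induction
    case (base s)
    then show ?case using zmul_simps(1,2)[of a] by (auto intro: range_eqI[of _ _ 0] range_eqI[of _ _ 1])
  next
    case (diff s t)
    then show ?case by (auto simp: zmul_diff[symmetric])
  qed
next
  have sum: "(\<Sum>i<n. a) \<in> group_closure {a}" for n :: nat
    by (induction n) (auto intro: group_closure_add group_closure.base)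
  fix x assume "x \<in> range (\<lambda>z. zmul z a)"
  then show "x \<in> group_closure {a}" using sum by (auto simp: zmul_def)
qed

lemma direct_sum_map_eq:
  assumes "finite F" "F \<subseteq> A" "\<And>a. a \<in> A - F \<Longrightarrow> x a = 0"
  shows "direct_sum_map A x = (\<Sum>a\<in>F. x a)"
  unfolding direct_sum_map_def using assms by (intro sum.mono_neutral_left) auto

lemma direct_sum_map_add:
  assumes "x \<in> direct_sum A" "y \<in> direct_sum A"
  shows "direct_sum_map A (\<lambda>a\<in>A. x a + y a) = direct_sum_map A x + direct_sum_map A y"
proof -
  define F where "F = {a \<in> A. x a \<noteq> 0} \<union> {a \<in> A. y a \<noteq> 0}"
  have F: "finite F" "F \<subseteq> A" using assms by (auto simp: F_def direct_sum_def)
  have "direct_sum_map A (\<lambda>a\<in>A. x a + y a) = (\<Sum>a\<in>F. (\<lambda>a\<in>A. x a + y a) a)"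
    by (rule direct_sum_map_eq[OF F]) (auto simp: F_def)
  also have "\<dots> = (\<Sum>a\<in>F. x a + y a)" using F by (intro sum.cong) auto
  also have "\<dots> = (\<Sum>a\<in>F. x a) + (\<Sum>a\<in>F. y a)" by (rule sum.distrib)
  also have "(\<Sum>a\<in>F. x a) = direct_sum_map A x"
    by (rule direct_sum_map_eq[OF F, symmetric]) (auto simp: F_def)
  also have "(\<Sum>a\<in>F. y a) = direct_sum_map A y"
    by (rule direct_sum_map_eq[OF F, symmetric]) (auto simp: F_def)
  finally show ?thesis .
qed

lemma direct_sum_map_inclusion:
  assumes "a \<in> A"
  shows "direct_sum_map A (\<lambda>b\<in>A. if b = a then c else 0) = c"
  using assms by (subst direct_sum_map_eq[of "{a}"]) auto

lemma direct_sum_map_unique: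
  fixes h :: "('a::ab_group_add \<Rightarrow> 'a) \<Rightarrow> 'a"
  assumes add: "\<And>x y. x \<in> direct_sum A \<Longrightarrow> y \<in> direct_sum A \<Longrightarrow>
                  h (\<lambda>a\<in>A. x a + y a) = h x + h y"
    and incl: "\<And>a c. a \<in> A \<Longrightarrow> c \<in> group_closure {a} \<Longrightarrow>
                  h (\<lambda>b\<in>A. if b = a then c else 0) = c"
    and x: "x \<in> direct_sum A"
  shows "h x = direct_sum_map A x"
proof -
  have restr: "(\<lambda>b\<in>A. if b \<in> F then x b else 0) \<in> direct_sum A"
    if "finite F" for F
    using x that by (auto simp: direct_sum_def PiE_def Pi_def
        intro: finite_subset[of _ F])
  have h0: "h (\<lambda>b\<in>A. 0) = 0"
  proof -
    have "(\<lambda>b\<in>A. 0) \<in> direct_sum A" using restr[of "{}"] by simp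
    from add[OF this this] show ?thesis by (simp cong: restrict_cong)
  qed
  have *: "h (\<lambda>b\<in>A. if b \<in> F then x b else 0) = (\<Sum>a\<in>F. x a)"
    if "finite F" "F \<subseteq> A" for F
    using that
  proof (induction F)
    case empty
    show ?case using h0 by (simp only: empty_iff if_False sum.empty)
  next
    case (insert a F)
    have a: "a \<in> A" "x a \<in> group_closure {a}"
      using insert x by (auto simp: direct_sum_def PiE_def Pi_def)
    have "(\<lambda>b\<in>A. if b \<in> {a} then x b else 0) = (\<lambda>b\<in>A. if b = a then x a else 0)"
      by auto
    then have sa: "(\<lambda>b\<in>A. if b = a then x a else 0) \<in> direct_sum A"
      using restr[of "{a}"] by simp
    have eq: "(\<lambda>b\<in>A. if b \<in> insert a F then x b else 0) =
      (\<lambda>c\<in>A. (\<lambda>b\<in>A. if b = a then x a else 0) c + (\<lambda>b\<in>A. if b \<in> F then x b else 0) c)"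
      using insert.hyps by (auto simp: restrict_def fun_eq_iff)
    have IH: "h (\<lambda>b\<in>A. if b \<in> F then x b else 0) = sum x F"
      by (rule insert.IH) (use insert.prems in simp)
    show ?case
      unfolding eq add[OF sa restr[OF insert.hyps(1)]] incl[OF a] IH
        sum.insert[OF insert.hyps] ..
  qed
  let ?F = "{a \<in> A. x a \<noteq> 0}"
  have "(\<lambda>b\<in>A. if b \<in> ?F then x b else 0) = x"
    using x by (auto simp: direct_sum_def fun_eq_iff PiE_def extensional_def)
  moreover have "finite ?F" using x by (simp add: direct_sum_def)
  ultimately show ?thesis using *[of ?F] by (simp add: direct_sum_map_def)
qed

lemma direct_sum_map_image: "direct_sum_map A ` direct_sum A = group_closure A"
proof (intro equalityI subsetI)
  have mono: "group_closure {a} \<subseteq> group_closure A" if "a \<in> A" for a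
  proof
    fix y assume "y \<in> group_closure {a}"
    then show "y \<in> group_closure A"
      by induction (use that in \<open>auto intro: group_closure.intros\<close>)
  qed
  have sum: "sum x F \<in> group_closure A"
    if "finite F" "\<And>a. a \<in> F \<Longrightarrow> x a \<in> group_closure A" for x :: "'a \<Rightarrow> 'a" and F
    using that by (induction F) (auto intro: group_closure_add)
  fix y assume "y \<in> direct_sum_map A ` direct_sum A"
  then obtain x where x: "x \<in> direct_sum A" "y = direct_sum_map A x" by auto
  have "x a \<in> group_closure A" if "a \<in> A" for a
    using x(1) mono[OF that] that by (auto simp: direct_sum_def PiE_def Pi_def)
  then show "y \<in> group_closure A"
    unfolding x(2) direct_sum_map_def using x(1) by (intro sum) (auto simp: direct_sum_def)
next
  fix y assume "y \<in> group_closure A"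
  then show "y \<in> direct_sum_map A ` direct_sum A"
  proof induction
    case (base s)
    show ?case
    proof (cases "s \<in> A")
      case True
      have "(\<lambda>b\<in>A. if b = s then s else 0) \<in> direct_sum A"
        by (auto simp: direct_sum_def intro: group_closure.base intro: finite_subset[of _ "{s}"])
      then show ?thesis using direct_sum_map_inclusion[OF True, of s] by (metis imageI)
    next
      case False
      then have "s = 0" using base by simp
      moreover have "(\<lambda>b\<in>A. 0) \<in> direct_sum A" by (auto simp: direct_sum_def)
      moreover have "direct_sum_map A (\<lambda>b\<in>A. 0) = 0"
        by (subst direct_sum_map_eq[of "{}"]) auto
      ultimately show ?thesis by (metis imageI)
    qed
  next
    case (diff s t)
    then obtain x y where x: "x \<in> direct_sum A" "s = direct_sum_map A x"
      and y: "y \<in> direct_sum A" "t = direct_sum_map A y" by auto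
    let ?d = "\<lambda>a\<in>A. x a - y a"
    have "{a \<in> A. ?d a \<noteq> 0} \<subseteq> {a \<in> A. x a \<noteq> 0} \<union> {a \<in> A. y a \<noteq> 0}" by auto
    then have "finite {a \<in> A. ?d a \<noteq> 0}"
      by (rule finite_subset) (use x y in \<open>simp add: direct_sum_def\<close>)
    then have d: "?d \<in> direct_sum A"
      using x y by (auto simp: direct_sum_def PiE_def Pi_def intro: group_closure.diff)
    have "(\<lambda>a\<in>A. ?d a + y a) = x"
      using x by (auto simp: direct_sum_def fun_eq_iff PiE_def extensional_def)
    then have "s = direct_sum_map A ?d + t"
      using direct_sum_map_add[OF d y(1)] x y by simp
    then have "s - t = direct_sum_map A ?d" by simp
    then show ?case using d by blast
  qed
qed

end

theory Submission
  imports Defs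
begin

text \<open>
  The only deep step is that an independent set in a precompact group yields a continuous
  \<open>\<K>\<^sub>A\<close>. By total boundedness, all but finitely many of the groups \<open>\<langle>a\<rangle>\<close> lie in a
  prescribed neighbourhood \<open>V\<close> of \<open>0\<close>, so it suffices to choose \<open>V\<close> such that every finite sum of
  elements generating subgroups inside \<open>V\<close> lies in a given \<open>W\<close>. Characters would give this at
  once; here they are avoided. Let \<open>f\<close> be a cutoff function (almost periodic,
  since \<open>G\<close> is precompact), \<open>M\<close> an invariant mean and \<open>\<phi>\<^sub>f(x) = M\<^sub>y f(x + y) f(y)\<close>. Averaging \<open>f\<close>
  successively along \<open>\<langle>h\<^sub>1\<rangle>, \<langle>h\<^sub>2\<rangle>, \<dots>\<close> changes \<open>\<phi>\<^sub>f\<close> by the functions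
  \<open>\<phi>\<^sub>d\<close>, \<open>d\<close> being the part of \<open>f\<close> removed in that step. These are mutually orthogonal
  and satisfy \<open>\<bar>\<phi>\<^sub>d\<bar> \<le> \<parallel>d\<parallel>\<^sup>2 \<le> \<epsilon>\<^sup>2\<close> if \<open>f\<close> varies by at most
  \<open>\<epsilon>\<close> along the \<open>\<langle>h\<^sub>i\<rangle>\<close>, while the \<open>\<parallel>d\<parallel>\<^sup>2\<close> add up to at most \<open>\<parallel>f\<parallel>\<^sup>2\<close>. Hence
  \<open>\<phi>\<^sub>f\<close> is within \<open>\<epsilon> \<parallel>f\<parallel>\<close> of a function invariant under \<open>\<Sum>\<^sub>i h\<^sub>i\<close>, whatever the number of
  the \<open>h\<^sub>i\<close>, so that \<open>\<phi>\<^sub>f\<close> and its translate by \<open>\<Sum>\<^sub>i h\<^sub>i\<close> cannot have disjoint supports.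
\<close>

section \<open>Means on bounded functions\<close>

definition bfun :: "('b \<Rightarrow> real) \<Rightarrow> bool" where
  "bfun u \<longleftrightarrow> (\<exists>b. \<forall>x. \<bar>u x\<bar> \<le> b)"

lemma bfunI: "(\<And>x. \<bar>u x\<bar> \<le> b) \<Longrightarrow> bfun u"
  unfolding bfun_def by blast

lemma bfunE:
  assumes "bfun u"
  obtains b where "b > 0" "\<And>x. \<bar>u x\<bar> \<le> b"
proof -
  obtain c where c: "\<And>x. \<bar>u x\<bar> \<le> c" using assms unfolding bfun_def by blast
  have "\<bar>u x\<bar> \<le> max c 1" for x using c[of x] by simp
  then show ?thesis using that[of "max c 1"] by simp
qed

lemma bfun_const [intro, simp]: "bfun (\<lambda>_. c)"
  by (rule bfunI[of _ "\<bar>c\<bar>"]) simp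

lemma bfun_add [intro]:
  assumes "bfun u" "bfun v"
  shows "bfun (\<lambda>x. u x + v x)"
proof -
  obtain b c where "\<And>x. \<bar>u x\<bar> \<le> b" "\<And>x. \<bar>v x\<bar> \<le> c"
    using assms unfolding bfun_def by blast
  then have "\<bar>u x + v x\<bar> \<le> b + c" for x by (meson abs_triangle_ineq add_mono order_trans)
  then show ?thesis by (rule bfunI)
qed

lemma bfun_mult [intro]:
  assumes "bfun u" "bfun v"
  shows "bfun (\<lambda>x. u x * v x)"
proof -
  obtain b where b: "b > 0" "\<And>x. \<bar>u x\<bar> \<le> b" using bfunE[OF assms(1)] by blast
  obtain c where c: "c > 0" "\<And>x. \<bar>v x\<bar> \<le> c" using bfunE[OF assms(2)] by blast
  have "\<bar>u x * v x\<bar> \<le> b * c" for x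
    unfolding abs_mult using b c by (intro mult_mono) (auto intro: less_imp_le)
  then show ?thesis by (rule bfunI)
qed

lemma bfun_diff [intro]:
  assumes "bfun u" "bfun v"
  shows "bfun (\<lambda>x. u x - v x)"
  using bfun_add[OF assms(1) bfun_mult[OF bfun_const[of "-1"] assms(2)]] by simp

lemma bfun_power2 [intro]: "bfun u \<Longrightarrow> bfun (\<lambda>x. (u x)\<^sup>2)"
  unfolding power2_eq_square by blast

lemma bfun_sum:
  "(\<And>i. i \<in> I \<Longrightarrow> bfun (u i)) \<Longrightarrow> bfun (\<lambda>x. \<Sum>i\<in>I. u i x)"
  by (induction I rule: infinite_finite_induct) auto

lemma bfun_reparam: "bfun u \<Longrightarrow> bfun (\<lambda>x. u (p x))"
  unfolding bfun_def by blast

text \<open>Finitely additive probabilities, seen as functionals. Functionals are total on all real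
  functions, but the laws constrain them on bounded ones only.\<close>

locale mean =
  fixes m :: "('b \<Rightarrow> real) \<Rightarrow> real"
  assumes add: "bfun u \<Longrightarrow> bfun v \<Longrightarrow> m (\<lambda>x. u x + v x) = m u + m v"
    and scale: "bfun u \<Longrightarrow> m (\<lambda>x. c * u x) = c * m u"
    and nonneg: "bfun u \<Longrightarrow> (\<And>x. 0 \<le> u x) \<Longrightarrow> 0 \<le> m u"
    and one: "m (\<lambda>_. 1) = 1"
begin

lemma const: "m (\<lambda>_. c) = c"
  using scale[of "\<lambda>_. 1" c] one by simp

lemma diff:
  assumes "bfun u" "bfun v"
  shows "m (\<lambda>x. u x - v x) = m u - m v"
  using add[OF assms(1) bfun_mult[OF bfun_const[of "-1"] assms(2)]] scale[OF assms(2), of "-1"]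
  by simp

lemma mono:
  assumes "bfun u" "bfun v" "\<And>x. u x \<le> v x"
  shows "m u \<le> m v"
proof -
  have "0 \<le> m (\<lambda>x. v x - u x)" using assms by (intro nonneg) auto
  then show ?thesis using diff[OF assms(2,1)] by simp
qed

lemma abs_le:
  assumes "\<And>x. \<bar>u x\<bar> \<le> b"
  shows "\<bar>m u\<bar> \<le> b"
proof -
  have u: "bfun u" using assms by (rule bfunI)
  have "u x \<le> b" "- b \<le> u x" for x using assms[of x] by auto
  then show ?thesis
    using mono[OF u bfun_const[of b]] mono[OF bfun_const[of "-b"] u] by (simp add: const)
qed

lemma abs_diff_le:
  assumes "bfun u" "bfun v" "\<And>x. \<bar>u x - v x\<bar> \<le> b"
  shows "\<bar>m u - m v\<bar> \<le> b"
  using abs_le[of "\<lambda>x. u x - v x" b] diff assms by simp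

lemma sum:
  assumes "\<And>i. i \<in> I \<Longrightarrow> bfun (u i)"
  shows "m (\<lambda>x. \<Sum>i\<in>I. u i x) = (\<Sum>i\<in>I. m (u i))"
  using assms by (induction I rule: infinite_finite_induct) (auto simp: const add bfun_sum)

end

locale invariant_mean = mean m for m :: "('b::ab_group_add \<Rightarrow> real) \<Rightarrow> real" +
  assumes shift: "bfun u \<Longrightarrow> m (\<lambda>x. u (k + x)) = m u"

section \<open>Invariant means\<close>

text \<open>Elements of \<open>S\<close> are added one at a time. Averaging a mean over the
  translates by \<open>0, s, ..., (N - 1) s\<close> makes it almost invariant under
  \<open>s\<close>, and since the group is abelian the estimates for the earlier elements
  survive.\<close>

lemma approximately_invariant_mean:
  fixes S :: "'b::ab_group_add set"
  assumes "finite S" "e > 0"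
  shows "\<exists>m. mean m \<and> (\<forall>s\<in>S. \<forall>u. (\<forall>x. \<bar>u x\<bar> \<le> 1) \<longrightarrow> \<bar>m (\<lambda>x. u (s + x)) - m u\<bar> \<le> e)"
  using assms(1)
proof induction
  case empty
  have "mean (\<lambda>u. u (0::'b))" by unfold_locales auto
  then show ?case by blast
next
  case (insert s S)
  then obtain m where "mean m" and m: "\<And>t u. t \<in> S \<Longrightarrow> (\<forall>x. \<bar>u x\<bar> \<le> 1) \<Longrightarrow> \<bar>m (\<lambda>x. u (t + x)) - m u\<bar> \<le> e"
    by blast
  interpret mean m by fact
  \<comment> \<open>After telescoping, only two terms of absolute value at most 1 remain, so
    \<open>2 / N\<close> has to be at most \<open>e\<close>.\<close>
  obtain N :: nat where N: "2 / e < N" using reals_Archimedean2 by blast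
  then have N0: "N > 0" using \<open>e > 0\<close> by (smt (verit) divide_pos_pos of_nat_0_less_iff)
  define c :: "nat \<Rightarrow> 'b" where "c j = (\<Sum>i<j. s)" for j
  define m' where "m' u = (\<Sum>j<N. m (\<lambda>x. u (c j + x))) / N" for u
  have "mean m'"
  proof
    fix u v :: "'b \<Rightarrow> real" and a :: real
    assume u: "bfun u"
    then have u': "bfun (\<lambda>x. u (c j + x))" for j by (rule bfun_reparam)
    show "m' (\<lambda>x. a * u x) = a * m' u"
      by (simp add: m'_def scale[OF u'] flip: sum_distrib_left)
    show "0 \<le> m' u" if "\<And>x. 0 \<le> u x"
      unfolding m'_def by (intro divide_nonneg_nonneg sum_nonneg nonneg u') (auto simp: that)
    assume "bfun v"
    then have v': "bfun (\<lambda>x. v (c j + x))" for j by (rule bfun_reparam)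
    show "m' (\<lambda>x. u x + v x) = m' u + m' v"
      by (simp add: m'_def add[OF u' v'] sum.distrib add_divide_distrib)
  next
    show "m' (\<lambda>_. 1) = 1" using N0 by (simp add: m'_def const)
  qed
  moreover have "\<bar>m' (\<lambda>x. u (t + x)) - m' u\<bar> \<le> e"
    if t: "t \<in> insert s S" and u: "\<forall>x. \<bar>u x\<bar> \<le> 1" for t u
  proof (cases "t = s")
    case True
    have "(\<Sum>j<N. m (\<lambda>x. u (s + (c j + x)))) - (\<Sum>j<N. m (\<lambda>x. u (c j + x)))
        = (\<Sum>j<N. m (\<lambda>x. u (c (Suc j) + x)) - m (\<lambda>x. u (c j + x)))"
      by (simp add: sum_subtractf c_def algebra_simps)
    also have "\<dots> = m (\<lambda>x. u (c N + x)) - m (\<lambda>x. u (c 0 + x))"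
      by (rule sum_lessThan_telescope)
    finally have eq: "m' (\<lambda>x. u (s + x)) - m' u = (m (\<lambda>x. u (c N + x)) - m (\<lambda>x. u (c 0 + x))) / N"
      unfolding m'_def by (simp only: diff_divide_distrib[symmetric])
    have "\<bar>m (\<lambda>x. u (c N + x))\<bar> \<le> 1" "\<bar>m (\<lambda>x. u (c 0 + x))\<bar> \<le> 1"
      by (intro abs_le; use u in simp)+
    then have "\<bar>m' (\<lambda>x. u (s + x)) - m' u\<bar> \<le> 2 / N"
      unfolding eq abs_divide by (intro frac_le) (use N0 in auto)
    also have "\<dots> \<le> e" using N N0 \<open>e > 0\<close> by (simp add: field_simps)
    finally show ?thesis using True by simp
  next
    case False
    \<comment> \<open>Each summand is the old estimate for \<open>t\<close>, applied to the
      translate of \<open>u\<close> by \<open>c j\<close>.\<close>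
    have "\<bar>\<Sum>j<N. m (\<lambda>x. u (c j + (t + x))) - m (\<lambda>x. u (c j + x))\<bar> \<le> (\<Sum>j<N. e)"
      using m[of t "\<lambda>x. u (c _ + x)"] t False u
      by (intro order_trans[OF sum_abs] sum_mono) auto
    then have "\<bar>\<Sum>j<N. m (\<lambda>x. u (t + (c j + x))) - m (\<lambda>x. u (c j + x))\<bar> \<le> N * e"
      by (simp add: add.left_commute)
    then show ?thesis using N0
      by (simp add: m'_def sum_subtractf field_simps flip: diff_divide_distrib)
  qed
  ultimately show ?case by blast
qed

text \<open>Being a mean and being invariant up to \<open>e\<close> for one translation and one
  function are closed conditions in a compact product of intervals. They have the finite
  intersection property by \<open>approximately_invariant_mean\<close>, and a common point is
  invariant up to every \<open>e\<close>.\<close>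

lemma invariant_mean_exists:
  "\<exists>m :: ('b::ab_group_add \<Rightarrow> real) \<Rightarrow> real. invariant_mean m"
proof -
  \<comment> \<open>These intervals contain the values of every mean; pinning unbounded functions to
    0 makes their product compact.\<close>
  define I :: "('b \<Rightarrow> real) \<Rightarrow> real set" where
    "I u = (if bfun u then {- (SUP x. \<bar>u x\<bar>)..(SUP x. \<bar>u x\<bar>)} else {0})" for u
  define K where "K = Pi\<^sub>E UNIV I"
  have "compactin (product_topology (\<lambda>_. euclidean) UNIV) K"
    unfolding K_def by (subst compactin_PiE) (auto simp: I_def)
  then have K: "compact K" by (simp add: euclidean_product_topology)
  define C :: "real \<Rightarrow> 'b \<times> ('b \<Rightarrow> real) \<Rightarrow> (('b \<Rightarrow> real) \<Rightarrow> real) set" where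
    "C e = (\<lambda>(s, u). {m. \<bar>m (\<lambda>x. u (s + x)) - m u\<bar> \<le> e})" for e
  define B where "B = {u :: 'b \<Rightarrow> real. \<forall>x. \<bar>u x\<bar> \<le> 1}"
  define L :: "(('b \<Rightarrow> real) \<Rightarrow> real) set" where
    "L = (\<Inter>u\<in>Collect bfun. \<Inter>v\<in>Collect bfun. {m. m (\<lambda>x. u x + v x) = m u + m v}) \<inter>
      (\<Inter>u\<in>Collect bfun. \<Inter>c. {m. m (\<lambda>x. c * u x) = c * m u}) \<inter>
      (\<Inter>u\<in>{u. bfun u \<and> (\<forall>x. 0 \<le> u x)}. {m. 0 \<le> m u}) \<inter> {m. m (\<lambda>_. 1) = 1}"
  have L: "m \<in> L \<longleftrightarrow> mean m" for m
    unfolding L_def mean_def by auto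
  have cont: "continuous_on UNIV (\<lambda>m. m u)" for u :: "'b \<Rightarrow> real"
    by (rule continuous_on_product_coordinates)
  have "closed L"
    unfolding L_def
    by (intro closed_Int closed_INT ballI closed_Collect_eq closed_Collect_le continuous_intros cont)
  have closedC: "closed (C e p)" for e p
    unfolding C_def by (cases p) (auto intro!: closed_Collect_le continuous_intros cont)
  define J where "J = {0::real<..} \<times> ((UNIV :: 'b set) \<times> B)"
  have "(L \<inter> K) \<inter> (\<Inter>(e, p)\<in>J. C e p) \<noteq> {}"
  proof (rule compact_imp_fip_image)
    show "compact (L \<inter> K)" using \<open>closed L\<close> K by (rule closed_Int_compact)
    show "closed (case i of (e, p) \<Rightarrow> C e p)" for i by (cases i) (auto intro: closedC)
    fix J' assume J': "finite J'" "J' \<subseteq> J"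
    \<comment> \<open>The 1 keeps \<open>Min\<close> meaningful when \<open>J'\<close> is
      empty.\<close>
    define e where "e = Min (insert 1 (fst ` J'))"
    have "e > 0" using J' unfolding e_def J_def by (subst Min_gr_iff) auto
    have e: "e \<le> d" if "(d, p) \<in> J'" for d p
      unfolding e_def using J' that by (intro Min_le) (auto simp: rev_image_eqI)
    obtain m where "mean m" and m: "\<And>s u. s \<in> (fst \<circ> snd) ` J' \<Longrightarrow> (\<forall>x. \<bar>u x\<bar> \<le> 1) \<Longrightarrow> \<bar>m (\<lambda>x. u (s + x)) - m u\<bar> \<le> e"
      using approximately_invariant_mean[of "(fst \<circ> snd) ` J'" e] J' \<open>e > 0\<close> by blast
    interpret mean m by fact
    \<comment> \<open>A mean may take any value on unbounded functions; resetting those values to 0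
      moves it into \<open>K\<close>.\<close>
    define m' where "m' u = (if bfun u then m u else 0)" for u
    have "mean m'"
      unfolding m'_def
      by unfold_locales (auto simp: add scale nonneg one intro: bfun_mult)
    moreover have "m' \<in> K"
      unfolding K_def
    proof (intro PiE_I)
      fix u :: "'b \<Rightarrow> real"
      show "m' u \<in> I u"
      proof (cases "bfun u")
        case True
        then have "bdd_above (range (\<lambda>x. \<bar>u x\<bar>))" by (auto simp: bfun_def)
        then have "\<bar>u x\<bar> \<le> (SUP x. \<bar>u x\<bar>)" for x by (intro cSUP_upper) auto
        from abs_le[of u, OF this] show ?thesis using True by (auto simp: m'_def I_def)
      qed (simp add: m'_def I_def)
    qed simp
    moreover have "m' \<in> C d (s, u)" if "(d, s, u) \<in> J'" for d s u
    proof -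
      have u: "\<forall>x. \<bar>u x\<bar> \<le> 1" using that J' by (auto simp: J_def B_def)
      then have "bfun u" "bfun (\<lambda>x. u (s + x))" by (auto intro!: bfunI)
      moreover have "\<bar>m (\<lambda>x. u (s + x)) - m u\<bar> \<le> d"
        using m[OF _ u, of s] e[OF that] that by force
      ultimately show ?thesis by (simp add: C_def m'_def)
    qed
    ultimately have "m' \<in> (L \<inter> K) \<inter> (\<Inter>i\<in>J'. case i of (e, p) \<Rightarrow> C e p)"
      by (auto simp: L)
    then show "(L \<inter> K) \<inter> (\<Inter>i\<in>J'. case i of (e, p) \<Rightarrow> C e p) \<noteq> {}" by (metis empty_iff)
  qed
  then obtain m where mL: "m \<in> L" and mJ: "m \<in> (\<Inter>(e, p)\<in>J. C e p)" by (metis Int_iff ex_in_conv)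
  have "mean m" using mL by (simp add: L)
  have m: "m \<in> C e (s, u)" if "e > 0" "u \<in> B" for e s u
    using INT_D[OF mJ, of "(e, s, u)"] that by (simp add: J_def)
  interpret mean m by fact
  have "m (\<lambda>x. u (k + x)) = m u" if u: "bfun u" for u k
  proof -
    obtain b where b: "b > 0" "\<And>x. \<bar>u x\<bar> \<le> b" using bfunE[OF u] by blast
    \<comment> \<open>\<open>B\<close> contains only functions bounded by 1, so \<open>u\<close> is
      rescaled first.\<close>
    define v where "v x = 1 / b * u x" for x
    have "v \<in> B" using b by (simp add: v_def B_def abs_mult)
    then have "\<bar>m (\<lambda>x. v (k + x)) - m v\<bar> \<le> e" if "e > 0" for e
      using m[OF that, of v k] by (simp add: C_def)
    then have "\<bar>m (\<lambda>x. v (k + x)) - m v\<bar> \<le> 0" by (rule field_le_epsilon[of _ 0, simplified])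
    moreover have "m v = 1 / b * m u" unfolding v_def by (rule scale[OF u])
    moreover have "m (\<lambda>x. v (k + x)) = 1 / b * m (\<lambda>x. u (k + x))"
      unfolding v_def by (rule scale[OF bfun_reparam[OF u]])
    ultimately show ?thesis using b by simp
  qed
  then have "invariant_mean m" by unfold_locales
  then show ?thesis by blast
qed

section \<open>Almost periodic functions\<close>

text \<open>
  The family \<open>F i\<close> is totally bounded for the supremum norm; a finite colouring of the indices
  is easier to pull back than a finite net.
\<close>

definition totally_bounded_family :: "('i \<Rightarrow> 'b \<Rightarrow> real) \<Rightarrow> bool" where
  "totally_bounded_family F \<longleftrightarrow>
     (\<forall>e>0. \<exists>c :: 'i \<Rightarrow> nat. finite (range c) \<and> (\<forall>i j y. c i = c j \<longrightarrow> \<bar>F i y - F j y\<bar> \<le> e))"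

lemma totally_bounded_familyE:
  assumes "totally_bounded_family F" "e > 0"
  obtains c :: "'i \<Rightarrow> nat" and r where "finite (range c)" "\<And>i j y. c i = c j \<Longrightarrow> \<bar>F i y - F j y\<bar> \<le> e"
    "\<And>i :: 'i. c (r (c i)) = c i"
proof -
  obtain c :: "'i \<Rightarrow> nat" where c: "finite (range c)" "\<And>i j y. c i = c j \<Longrightarrow> \<bar>F i y - F j y\<bar> \<le> e"
    using assms unfolding totally_bounded_family_def by blast
  show ?thesis by (rule that[of c "inv c"]) (use c in \<open>auto simp: f_inv_into_f\<close>)
qed

lemma totally_bounded_family_net:
  assumes "\<And>e. e > 0 \<Longrightarrow> \<exists>S. finite S \<and> (\<forall>i. \<exists>s\<in>S. \<forall>y. \<bar>F i y - F s y\<bar> \<le> e)"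
  shows "totally_bounded_family F"
  unfolding totally_bounded_family_def
proof (intro allI impI)
  fix e :: real assume "e > 0"
  then obtain S where S: "finite S" "\<And>i. \<exists>s\<in>S. \<forall>y. \<bar>F i y - F s y\<bar> \<le> e / 2"
    using assms[of "e / 2"] by auto
  then obtain n where n: "\<And>i. n i \<in> S" "\<And>i y. \<bar>F i y - F (n i) y\<bar> \<le> e / 2" by metis
  define c where "c i = to_nat_on S (n i)" for i
  have "range c \<subseteq> to_nat_on S ` S" using n by (auto simp: c_def)
  then have "finite (range c)" using S(1) by (meson finite_imageI finite_subset)
  moreover have "\<bar>F i y - F j y\<bar> \<le> e" if "c i = c j" for i j y
  proof -
    have eq: "n i = n j" using that n(1) countable_finite[OF S(1)] by (simp add: c_def)
    show ?thesis using n(2)[of i y] n(2)[of j y] unfolding eq by linarith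
  qed
  ultimately show "\<exists>c :: _ \<Rightarrow> nat. finite (range c) \<and> (\<forall>i j y. c i = c j \<longrightarrow> \<bar>F i y - F j y\<bar> \<le> e)"
    by blast
qed

lemma totally_bounded_family_reparam:
  assumes "totally_bounded_family F"
  shows "totally_bounded_family (\<lambda>i y. F (p i) (q y))"
  unfolding totally_bounded_family_def
proof (intro allI impI)
  fix e :: real assume "e > 0"
  then obtain c :: "_ \<Rightarrow> nat" where c: "finite (range c)" "\<And>i j y. c i = c j \<Longrightarrow> \<bar>F i y - F j y\<bar> \<le> e"
    using assms unfolding totally_bounded_family_def by blast
  have "finite (range (\<lambda>i. c (p i)))" using c(1) by (rule finite_subset[rotated]) auto
  then show "\<exists>c :: _ \<Rightarrow> nat. finite (range c) \<and> (\<forall>i j y. c i = c j \<longrightarrow> \<bar>F (p i) (q y) - F (p j) (q y)\<bar> \<le> e)"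
    using c(2) by (intro exI[of _ "\<lambda>i. c (p i)"]) auto
qed

text \<open>Pairing two colourings gives one that is fine enough for both families, so total
  boundedness passes to everything that depends on them in a Lipschitz way. When there is only one
  family, it is supplied twice.\<close>

lemma totally_bounded_family_lipschitz2:
  assumes "totally_bounded_family F" "totally_bounded_family G" "K > 0"
    and H: "\<And>i j y e. (\<And>z. \<bar>F i z - F j z\<bar> \<le> e) \<Longrightarrow> (\<And>z. \<bar>G i z - G j z\<bar> \<le> e) \<Longrightarrow> \<bar>H i y - H j y\<bar> \<le> K * e"
  shows "totally_bounded_family H"
  unfolding totally_bounded_family_def
proof (intro allI impI)
  fix e :: real assume "e > 0"
  then have e: "e / K > 0" using \<open>K > 0\<close> by simp
  obtain c :: "_ \<Rightarrow> nat" where c: "finite (range c)" "\<And>i j y. c i = c j \<Longrightarrow> \<bar>F i y - F j y\<bar> \<le> e / K"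
    using assms(1) e unfolding totally_bounded_family_def by blast
  obtain d :: "_ \<Rightarrow> nat" where d: "finite (range d)" "\<And>i j y. d i = d j \<Longrightarrow> \<bar>G i y - G j y\<bar> \<le> e / K"
    using assms(2) e unfolding totally_bounded_family_def by blast
  define p where "p i = prod_encode (c i, d i)" for i
  have "range p \<subseteq> prod_encode ` (range c \<times> range d)" by (auto simp: p_def)
  then have "finite (range p)" using c(1) d(1) by (meson finite_SigmaI finite_imageI finite_subset)
  moreover have "\<bar>H i y - H j y\<bar> \<le> e" if "p i = p j" for i j y
    using H[of i j "e / K" y] c(2)[of i j] d(2)[of i j] that \<open>K > 0\<close> by (simp add: p_def)
  ultimately show "\<exists>c :: _ \<Rightarrow> nat. finite (range c) \<and> (\<forall>i j y. c i = c j \<longrightarrow> \<bar>H i y - H j y\<bar> \<le> e)"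
    by blast
qed

lemma totally_bounded_family_scale:
  assumes "totally_bounded_family F" "bfun v"
  shows "totally_bounded_family (\<lambda>i y. F i y * v y)"
proof -
  obtain b where b: "b > 0" "\<And>y. \<bar>v y\<bar> \<le> b" using bfunE[OF assms(2)] by blast
  have "\<bar>F i y * v y - F j y * v y\<bar> \<le> b * e" if "\<And>z. \<bar>F i z - F j z\<bar> \<le> e" for i j y e
    using mult_mono[OF b(2)[of y] that[of y]] b by (simp add: abs_mult mult.commute flip: right_diff_distrib)
  then show ?thesis by (rule totally_bounded_family_lipschitz2[OF assms(1,1) b(1)])
qed

text \<open>A Fubini theorem, which finitely additive means do not obey in general. Total
  boundedness approximates \<open>F\<close> uniformly by finite sums of products of a function of
  \<open>i\<close> and a function of \<open>y\<close>, and for these linearity suffices.\<close>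

lemma means_commute:
  assumes "mean m" "mean l" "totally_bounded_family F" and b: "\<And>i y. \<bar>F i y\<bar> \<le> b"
  shows "m (\<lambda>i. l (\<lambda>y. F i y)) = l (\<lambda>y. m (\<lambda>i. F i y))"
proof -
  interpret m: mean m by fact
  interpret l: mean l by fact
  have bF: "bfun (F i)" "bfun (\<lambda>i. F i y)" for i y by (auto intro: bfunI b)
  have "\<bar>m (\<lambda>i. l (\<lambda>y. F i y)) - l (\<lambda>y. m (\<lambda>i. F i y))\<bar> \<le> 0 + e" if "e > 0" for e
  proof -
    have "e / 2 > 0" using that by simp
    then obtain c :: "_ \<Rightarrow> nat" and r where c: "finite (range c)"
      "\<And>i j y. c i = c j \<Longrightarrow> \<bar>F i y - F j y\<bar> \<le> e / 2" "\<And>i. c (r (c i)) = c i"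
      using totally_bounded_familyE[OF assms(3)] by blast
    define ind :: "nat \<Rightarrow> _ \<Rightarrow> real" where "ind k i = of_bool (c i = k)" for k i
    \<comment> \<open>Row \<open>i\<close> of \<open>F\<close> is replaced by the row chosen for its
      colour, written as a finite sum through which both means can be pulled.\<close>
    define G where "G i y = (\<Sum>k\<in>range c. ind k i * F (r k) y)" for i y
    have G: "G i y = F (r (c i)) y" for i y
    proof -
      have "ind k i * F (r k) y = (if k = c i then F (r (c i)) y else 0)" for k by (simp add: ind_def)
      then show ?thesis unfolding G_def using c(1) by simp
    qed
    have FG: "\<bar>F i y - G i y\<bar> \<le> e / 2" for i y
      unfolding G using c(2)[of i "r (c i)"] c(3) by simp
    have bG: "bfun (G i)" "bfun (\<lambda>i. G i y)" for i y by (intro bfunI[of _ b], simp add: G b)+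
    have bind: "bfun (ind k)" for k by (rule bfunI[of _ 1]) (simp add: ind_def)
    have blF: "bfun (\<lambda>i. l (\<lambda>y. F i y))" "bfun (\<lambda>i. l (\<lambda>y. G i y))"
      by (auto intro!: bfunI[of _ b] l.abs_le b simp: G)
    have bmF: "bfun (\<lambda>y. m (\<lambda>i. F i y))" "bfun (\<lambda>y. m (\<lambda>i. G i y))"
      by (auto intro!: bfunI[of _ b] m.abs_le b simp: G)
    have mind: "m (\<lambda>i. ind k i * a) = m (ind k) * a" for k a
      using m.scale[OF bind, of a k] by (simp add: mult.commute)
    have "\<bar>m (\<lambda>i. l (\<lambda>y. F i y)) - m (\<lambda>i. l (\<lambda>y. G i y))\<bar> \<le> e / 2"
      by (intro m.abs_diff_le l.abs_diff_le blF bF bG FG)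
    moreover have "\<bar>l (\<lambda>y. m (\<lambda>i. F i y)) - l (\<lambda>y. m (\<lambda>i. G i y))\<bar> \<le> e / 2"
      by (intro m.abs_diff_le l.abs_diff_le bmF bF bG FG)
    moreover have "m (\<lambda>i. l (\<lambda>y. G i y)) = (\<Sum>k\<in>range c. m (ind k) * l (F (r k)))"
    proof -
      have "l (\<lambda>y. G i y) = (\<Sum>k\<in>range c. ind k i * l (F (r k)))" for i
        unfolding G_def by (subst l.sum) (auto simp: l.scale bF)
      then show ?thesis by (simp add: m.sum mind bind bfun_mult)
    qed
    moreover have "l (\<lambda>y. m (\<lambda>i. G i y)) = (\<Sum>k\<in>range c. m (ind k) * l (F (r k)))"
    proof -
      have "m (\<lambda>i. G i y) = (\<Sum>k\<in>range c. m (ind k) * F (r k) y)" for y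
        unfolding G_def
        by (simp add: m.sum mind bind bfun_mult)
      then show ?thesis by (simp add: l.sum l.scale bF bfun_mult)
    qed
    ultimately show ?thesis by linarith
  qed
  then have "\<bar>m (\<lambda>i. l (\<lambda>y. F i y)) - l (\<lambda>y. m (\<lambda>i. F i y))\<bar> \<le> 0" by (rule field_le_epsilon)
  then show ?thesis by simp
qed

text \<open>Bochner's form of almost periodicity: the translates of \<open>u\<close> are totally
  bounded in the supremum norm.\<close>

definition almost_periodic :: "('a::ab_group_add \<Rightarrow> real) \<Rightarrow> bool" where
  "almost_periodic u \<longleftrightarrow> totally_bounded_family (\<lambda>x y. u (x + y))"

lemma almost_periodic_bfun:
  assumes "almost_periodic u"
  shows "bfun u"
proof -
  obtain c :: "_ \<Rightarrow> nat" and r where c: "finite (range c)"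
    "\<And>i j y. c i = c j \<Longrightarrow> \<bar>u (i + y) - u (j + y)\<bar> \<le> 1" "\<And>i. c (r (c i)) = c i"
    using totally_bounded_familyE[OF assms[unfolded almost_periodic_def] zero_less_one] by blast
  have "\<bar>u x\<bar> \<le> 1 + (\<Sum>k\<in>range c. \<bar>u (r k)\<bar>)" for x
  proof -
    have "\<bar>u x\<bar> \<le> 1 + \<bar>u (r (c x))\<bar>" using c(2)[of x "r (c x)" 0] c(3) by simp
    also have "\<bar>u (r (c x))\<bar> \<le> (\<Sum>k\<in>range c. \<bar>u (r k)\<bar>)"
      using c(1) by (intro member_le_sum) auto
    finally show ?thesis by simp
  qed
  then show ?thesis by (rule bfunI)
qed

lemma almost_periodic_shift:
  assumes "almost_periodic u"
  shows "almost_periodic (\<lambda>y. u (k + y))"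
  using totally_bounded_family_reparam[OF assms[unfolded almost_periodic_def], of "\<lambda>x. k + x" "\<lambda>x. x"]
  by (simp add: almost_periodic_def add.assoc)

lemma almost_periodic_diff:
  assumes "almost_periodic u" "almost_periodic v"
  shows "almost_periodic (\<lambda>x. u x - v x)"
  unfolding almost_periodic_def
proof (rule totally_bounded_family_lipschitz2[OF assms[unfolded almost_periodic_def]])
  show "(2 :: real) > 0" by simp
  fix i j y and e :: real
  assume "\<And>z. \<bar>u (i + z) - u (j + z)\<bar> \<le> e" "\<And>z. \<bar>v (i + z) - v (j + z)\<bar> \<le> e"
  from this[of y] show "\<bar>u (i + y) - v (i + y) - (u (j + y) - v (j + y))\<bar> \<le> 2 * e" by linarith
qed

lemma almost_periodic_mult:
  assumes "almost_periodic u" "almost_periodic v"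
  shows "almost_periodic (\<lambda>x. u x * v x)"
proof -
  obtain a where a: "a > 0" "\<And>y. \<bar>u y\<bar> \<le> a" using bfunE[OF almost_periodic_bfun[OF assms(1)]] by blast
  obtain b where b: "b > 0" "\<And>y. \<bar>v y\<bar> \<le> b" using bfunE[OF almost_periodic_bfun[OF assms(2)]] by blast
  have "\<bar>u (i + y) * v (i + y) - u (j + y) * v (j + y)\<bar> \<le> (a + b) * e"
    if u: "\<And>z. \<bar>u (i + z) - u (j + z)\<bar> \<le> e" and v: "\<And>z. \<bar>v (i + z) - v (j + z)\<bar> \<le> e" for i j y e
  proof -
    have "u (i + y) * v (i + y) - u (j + y) * v (j + y)
      = u (i + y) * (v (i + y) - v (j + y)) + (u (i + y) - u (j + y)) * v (j + y)"
      by (simp add: algebra_simps)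
    also have "\<bar>\<dots>\<bar> \<le> a * e + e * b"
      using a b u[of y] v[of y]
      by (intro order_trans[OF abs_triangle_ineq] add_mono) (auto simp: abs_mult intro!: mult_mono)
    finally show ?thesis by (simp add: algebra_simps)
  qed
  then show ?thesis unfolding almost_periodic_def
    by (intro totally_bounded_family_lipschitz2[OF assms[unfolded almost_periodic_def], of "a + b"])
      (use a b in auto)
qed

text \<open>Finitely many translates of \<open>u\<close> add up to at least \<open>u x0 / 2\<close>
  everywhere, while by invariance the mean of their sum is a multiple of \<open>m u\<close>.\<close>

lemma (in invariant_mean) almost_periodic_pos:
  assumes u: "almost_periodic u" and nn: "\<And>x. 0 \<le> u x" and x0: "u x0 > 0"
  shows "m u > 0"
proof -
  have bu: "bfun u" by (rule almost_periodic_bfun[OF u])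
  have "u x0 / 2 > 0" using x0 by simp
  then obtain c :: "_ \<Rightarrow> nat" and r where c: "finite (range c)"
    "\<And>i j y. c i = c j \<Longrightarrow> \<bar>u (i + y) - u (j + y)\<bar> \<le> u x0 / 2" "\<And>i. c (r (c i)) = c i"
    using totally_bounded_familyE[OF u[unfolded almost_periodic_def]] by blast
  have "u x0 / 2 \<le> (\<Sum>k\<in>range c. u (r k + z))" for z
  proof -
    \<comment> \<open>The translate of \<open>u\<close> by \<open>x0 - z\<close> takes the value
      \<open>u x0\<close> at \<open>z\<close>, so the translate chosen for its colour is close to
      \<open>u x0\<close> there.\<close>
    have "\<bar>u x0 - u (r (c (x0 - z)) + z)\<bar> \<le> u x0 / 2"
      using c(2)[of "x0 - z" "r (c (x0 - z))" z] c(3) by simp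
    then have "u x0 / 2 \<le> u (r (c (x0 - z)) + z)" by linarith
    also have "\<dots> \<le> (\<Sum>k\<in>range c. u (r k + z))"
      using c(1) by (intro member_le_sum[where f = "\<lambda>k. u (r k + z)"]) (auto simp: nn)
    finally show ?thesis .
  qed
  then have "m (\<lambda>_. u x0 / 2) \<le> m (\<lambda>z. \<Sum>k\<in>range c. u (r k + z))"
    by (intro mono bfun_sum bfun_const bfun_reparam[OF bu])
  also have "\<dots> = (\<Sum>k\<in>range c. m u)"
    by (subst sum) (auto intro: bfun_reparam[OF bu] simp: shift[OF bu])
  also have "\<dots> = card (range c) * m u" by simp
  finally have "card (range c) * m u > 0" using x0 by (simp add: const)
  then show ?thesis by (metis mult_nonneg_nonpos not_le of_nat_0_le_iff)
qed

section \<open>Autocorrelation\<close>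

lemma bfun_almost_periodic_shift: "almost_periodic u \<Longrightarrow> bfun (\<lambda>y. u (k + y))"
  by (intro almost_periodic_bfun almost_periodic_shift)

lemmas almost_periodic_intros =
  bfun_almost_periodic_shift almost_periodic_bfun almost_periodic_diff almost_periodic_mult
  almost_periodic_shift

context invariant_mean begin

definition autocorrelation :: "('b \<Rightarrow> real) \<Rightarrow> 'b \<Rightarrow> real" where
  "autocorrelation f x = m (\<lambda>y. f (x + y) * f y)"

lemma autocorrelation_0: "autocorrelation f 0 = m (\<lambda>y. (f y)\<^sup>2)"
  by (simp add: autocorrelation_def power2_eq_square)

lemma almost_periodic_autocorrelation:
  assumes f: "almost_periodic f"
  shows "almost_periodic (autocorrelation f)"
  unfolding almost_periodic_def
proof -
  obtain b where b: "b > 0" "\<And>y. \<bar>f y\<bar> \<le> b" using bfunE[OF almost_periodic_bfun[OF f]] by blast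
  have "\<bar>autocorrelation f (i + y) - autocorrelation f (j + y)\<bar> \<le> b * e"
    if e: "\<And>z. \<bar>f (i + z) - f (j + z)\<bar> \<le> e" for i j y e
    unfolding autocorrelation_def
  proof (intro abs_diff_le bfun_mult almost_periodic_intros f)
    fix z
    have "\<bar>f (i + y + z) * f z - f (j + y + z) * f z\<bar> = \<bar>f z\<bar> * \<bar>f (i + (y + z)) - f (j + (y + z))\<bar>"
      by (simp add: add.assoc flip: abs_mult right_diff_distrib) (simp add: algebra_simps)
    also have "\<dots> \<le> b * e" using b e by (intro mult_mono) (auto intro: less_imp_le)
    finally show "\<bar>f (i + y + z) * f z - f (j + y + z) * f z\<bar> \<le> b * e" .
  qed
  then show "totally_bounded_family (\<lambda>x y. autocorrelation f (x + y))"
    by (rule totally_bounded_family_lipschitz2[OF f[unfolded almost_periodic_def] f[unfolded almost_periodic_def] b(1)])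
qed

text \<open>Cauchy-Schwarz for a function and its translate, which have equal norms by invariance:
  expand the nonnegative means of the squares of \<open>f (x + y) + f y\<close> and
  \<open>f (x + y) - f y\<close>.\<close>

lemma abs_autocorrelation_le:
  assumes f: "almost_periodic f"
  shows "\<bar>autocorrelation f x\<bar> \<le> m (\<lambda>y. (f y)\<^sup>2)"
proof -
  have bf: "bfun f" by (intro almost_periodic_intros f)
  have s: "m (\<lambda>y. (f (x + y))\<^sup>2) = m (\<lambda>y. (f y)\<^sup>2)"
    by (rule shift) (intro bfun_power2 bf)
  have bs: "bfun (\<lambda>y. f (x + y))" by (rule bfun_reparam[OF bf])
  have "0 \<le> m (\<lambda>y. (f (x + y) - f y)\<^sup>2)" "0 \<le> m (\<lambda>y. (f (x + y) + f y)\<^sup>2)"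
    by (intro nonneg bfun_power2 bfun_diff bfun_add bf bs; simp)+
  moreover have "m (\<lambda>y. (f (x + y) + c * f y)\<^sup>2) = (1 + c\<^sup>2) * m (\<lambda>y. (f y)\<^sup>2) + 2 * c * autocorrelation f x" for c
  proof -
    have "(\<lambda>y. (f (x + y) + c * f y)\<^sup>2) = (\<lambda>y. ((f (x + y))\<^sup>2 + c\<^sup>2 * (f y)\<^sup>2) + (2 * c) * (f (x + y) * f y))"
      by (simp add: power2_eq_square algebra_simps)
    then have "m (\<lambda>y. (f (x + y) + c * f y)\<^sup>2)
      = m (\<lambda>y. ((f (x + y))\<^sup>2 + c\<^sup>2 * (f y)\<^sup>2) + (2 * c) * (f (x + y) * f y))" by (rule arg_cong)
    also have "\<dots> = (m (\<lambda>y. (f (x + y))\<^sup>2) + c\<^sup>2 * m (\<lambda>y. (f y)\<^sup>2)) + 2 * c * autocorrelation f x"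
      unfolding autocorrelation_def
      by (subst add scale, (intro bfun_power2 bfun_mult bfun_add bfun_const bf bs)+)+ simp
    finally show ?thesis unfolding s by (simp add: algebra_simps)
  qed
  from this[of 1] this[of "-1"]
  have "m (\<lambda>y. (f (x + y) + f y)\<^sup>2) = 2 * m (\<lambda>y. (f y)\<^sup>2) + 2 * autocorrelation f x"
    "m (\<lambda>y. (f (x + y) - f y)\<^sup>2) = 2 * m (\<lambda>y. (f y)\<^sup>2) - 2 * autocorrelation f x" by simp_all
  ultimately show ?thesis by linarith
qed

end

section \<open>Averaging along cyclic subgroups\<close>

locale invariant_mean_pair = m: invariant_mean m + l: invariant_mean l
  for m :: "('a::ab_group_add \<Rightarrow> real) \<Rightarrow> real" and l :: "(int \<Rightarrow> real) \<Rightarrow> real"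
begin

text \<open>The conditional expectation onto the functions invariant under \<open><h>\<close>.
  Parametrising the multiples of \<open>h\<close> by the integers lets a single mean
  \<open>l\<close> serve every \<open>h\<close>, whatever its order.\<close>

definition proj :: "'a \<Rightarrow> ('a \<Rightarrow> real) \<Rightarrow> 'a \<Rightarrow> real" where
  "proj h u x = l (\<lambda>j. u (zmul j h + x))"

lemma proj_shift: "proj h (\<lambda>y. u (x + y)) = (\<lambda>y. proj h u (x + y))"
  by (simp add: proj_def fun_eq_iff add.left_commute)

lemma proj_invariant:
  assumes "bfun u"
  shows "proj h u (zmul k h + x) = proj h u x"
proof -
  have "proj h u (zmul k h + x) = l (\<lambda>j. u (zmul (k + j) h + x))"
    by (simp add: proj_def zmul_simps(3) ac_simps)
  also have "\<dots> = proj h u x"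
    unfolding proj_def by (rule l.shift) (rule bfun_reparam[OF assms])
  finally show ?thesis .
qed

lemma proj_id: "(\<And>k. u (zmul k h + x) = u x) \<Longrightarrow> proj h u x = u x"
  by (simp add: proj_def l.const)

lemma proj_diff: "bfun u \<Longrightarrow> bfun v \<Longrightarrow> proj h (\<lambda>x. u x - v x) x = proj h u x - proj h v x"
  unfolding proj_def by (rule l.diff; rule bfun_reparam)

lemma almost_periodic_proj:
  assumes u: "almost_periodic u"
  shows "almost_periodic (proj h u)"
  unfolding almost_periodic_def
proof (rule totally_bounded_family_lipschitz2[OF u[unfolded almost_periodic_def] u[unfolded almost_periodic_def], of 1])
  fix i j y and e :: real assume e: "\<And>z. \<bar>u (i + z) - u (j + z)\<bar> \<le> e"
  have "\<bar>proj h u (i + y) - proj h u (j + y)\<bar> \<le> e"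
    unfolding proj_def
  proof (intro l.abs_diff_le bfun_reparam[OF almost_periodic_bfun[OF u]])
    show "\<bar>u (zmul k h + (i + y)) - u (zmul k h + (j + y))\<bar> \<le> e" for k
      using e[of "zmul k h + y"] by (simp add: add.left_commute)
  qed
  then show "\<bar>proj h u (i + y) - proj h u (j + y)\<bar> \<le> 1 * e" by simp
qed simp

lemma totally_bounded_orbit:
  assumes u: "almost_periodic u" and v: "bfun v"
  shows "totally_bounded_family (\<lambda>j y. u (zmul j h + (x + y)) * v y)"
  by (rule totally_bounded_family_scale[OF
      totally_bounded_family_reparam[OF u[unfolded almost_periodic_def], of "\<lambda>j. zmul j h" "\<lambda>y. x + y"] v])

text \<open>The averages over \<open>j\<close> and \<open>y\<close> are interchanged by
  \<open>means_commute\<close>. The shift \<open>x\<close> makes the identity applicable to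
  autocorrelations.\<close>

lemma mean_proj_mult:
  assumes u: "almost_periodic u" and v: "bfun v"
  shows "l (\<lambda>j. m (\<lambda>y. u (zmul j h + (x + y)) * v y)) = m (\<lambda>y. proj h u (x + y) * v y)"
proof -
  obtain b where b: "b > 0" "\<And>y. \<bar>u y\<bar> \<le> b" using bfunE[OF almost_periodic_bfun[OF u]] by blast
  obtain c where c: "c > 0" "\<And>y. \<bar>v y\<bar> \<le> c" using bfunE[OF v] by blast
  have "l (\<lambda>j. m (\<lambda>y. u (zmul j h + (x + y)) * v y)) = m (\<lambda>y. l (\<lambda>j. u (zmul j h + (x + y)) * v y))"
  proof (rule means_commute[OF l.mean_axioms m.mean_axioms totally_bounded_orbit[OF u v]])
    show "\<bar>u (zmul j h + (x + y)) * v y\<bar> \<le> b * c" for j y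
      unfolding abs_mult using b c by (intro mult_mono) (auto intro: less_imp_le)
  qed
  also have "(\<lambda>y. l (\<lambda>j. u (zmul j h + (x + y)) * v y)) = (\<lambda>y. proj h u (x + y) * v y)"
  proof
    show "l (\<lambda>j. u (zmul j h + (x + y)) * v y) = proj h u (x + y) * v y" for y
      using l.scale[OF bfun_reparam[OF almost_periodic_bfun[OF u]], of "v y" "\<lambda>j. zmul j h + (x + y)"]
      by (simp add: proj_def mult.commute)
  qed
  finally show ?thesis .
qed

text \<open>Against an invariant \<open>v\<close>, invariance of \<open>m\<close> absorbs the
  translation of \<open>u\<close> by \<open>zmul j h\<close>, so averaging over \<open>j\<close>
  changes nothing. This makes \<open>proj h\<close> an orthogonal projection.\<close>

lemma proj_adjoint:
  assumes u: "almost_periodic u" and v: "bfun v" and inv: "\<And>k x. v (zmul k h + x) = v x"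
  shows "m (\<lambda>y. proj h u y * v y) = m (\<lambda>y. u y * v y)"
proof -
  have "m (\<lambda>y. u (zmul j h + y) * v y) = m (\<lambda>y. u y * v y)" for j
    using m.shift[of "\<lambda>y. u y * v y" "zmul j h"] u v
    by (simp add: inv bfun_mult almost_periodic_bfun)
  then show ?thesis using mean_proj_mult[OF u v, of h 0] by (simp add: l.const)
qed

abbreviation corr where "corr \<equiv> m.autocorrelation"

text \<open>Averaging an autocorrelation affects one factor only; hence a function that averages to
  0 along \<open>h\<close> has an autocorrelation that averages to 0 as well.\<close>

lemma proj_corr:
  assumes f: "almost_periodic f"
  shows "proj h (corr f) x = m (\<lambda>y. proj h f (x + y) * f y)"
  using mean_proj_mult[OF f almost_periodic_bfun[OF f], of h x]
  by (simp add: proj_def m.autocorrelation_def add.assoc)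

text \<open>The invariant part of \<open>f\<close> and the removed part \<open>d\<close> stay
  orthogonal after arbitrary translations, since \<open>proj h\<close> commutes with translations.
  So the cross terms of the autocorrelation vanish.\<close>

lemma corr_split:
  fixes f :: "'a \<Rightarrow> real" and h :: 'a
  assumes f: "almost_periodic f"
  defines "d \<equiv> \<lambda>x. f x - proj h f x"
  shows "corr f x = corr (proj h f) x + corr d x" and "proj h d x = 0"
proof -
  define g where "g = proj h f"
  have g: "almost_periodic g" unfolding g_def by (rule almost_periodic_proj[OF f])
  have d: "almost_periodic d" unfolding d_def by (intro almost_periodic_diff almost_periodic_proj f)
  have inv: "g (zmul k h + z) = g z" for k z
    unfolding g_def by (rule proj_invariant) (rule almost_periodic_bfun[OF f])
  have "proj h d z = 0" for z
    unfolding d_def g_def[symmetric]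
    by (simp add: proj_diff proj_id[OF inv] almost_periodic_bfun f g) (simp add: g_def)
  then show "proj h d x = 0" .
  have orth: "m (\<lambda>y. d (a + y) * g (b + y)) = 0" for a b
  proof -
    have "g (b + (zmul k h + z)) = g (b + z)" for k z
      using inv[of k "b + z"] by (simp add: add.left_commute)
    then have "m (\<lambda>y. d (a + y) * g (b + y)) = m (\<lambda>y. proj h (\<lambda>y. d (a + y)) y * g (b + y))"
      by (intro proj_adjoint[symmetric] almost_periodic_intros d g)
    then show ?thesis by (simp add: proj_shift \<open>\<And>z. proj h d z = 0\<close> m.const)
  qed
  \<comment> \<open>The form \<open>0 + y\<close> lets \<open>orth\<close> match both cross
    terms.\<close>
  have "(\<lambda>y. f (x + y) * f y) = (\<lambda>y. (g (x + y) * g y + d (x + y) * d y) + (d (x + y) * g (0 + y) + d (0 + y) * g (x + y)))"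
    by (simp add: d_def g_def algebra_simps)
  then have "corr f x = m \<dots>" by (simp add: m.autocorrelation_def)
  also have "\<dots> = (m (\<lambda>y. g (x + y) * g y) + m (\<lambda>y. d (x + y) * d y))
     + (m (\<lambda>y. d (x + y) * g (0 + y)) + m (\<lambda>y. d (0 + y) * g (x + y)))"
    by (subst m.add, (intro bfun_add bfun_mult almost_periodic_intros d g)+)+ simp
  finally show "corr f x = corr (proj h f) x + corr d x"
    by (simp only: orth) (simp add: m.autocorrelation_def g_def)
qed

text \<open>Induction on \<open>I\<close>: average along one \<open>h i\<close>, then apply the
  hypothesis to the result \<open>g\<close>. The clause on periods ensures that the later averages
  keep the invariance under \<open>h i\<close>. The errors of the steps are orthogonal, and bounding
  them by differences of squared norms makes the estimate telescope, independently of the size of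
  \<open>I\<close>.\<close>

lemma autocorrelation_approx:
  fixes h :: "'i \<Rightarrow> 'a"
  assumes "finite I" "almost_periodic f"
    "\<And>i k x. i \<in> I \<Longrightarrow> \<bar>f x - f (zmul k (h i) + x)\<bar> \<le> e" "e \<ge> 0"
  shows "\<exists>f'. almost_periodic f' \<and>
    (\<forall>k. (\<forall>x. f (k + x) = f x) \<longrightarrow> (\<forall>x. f' (k + x) = f' x)) \<and>
    (\<forall>i\<in>I. \<forall>k x. f' (zmul k (h i) + x) = f' x) \<and>
    m (\<lambda>x. (corr f x - corr f' x)\<^sup>2) \<le> e\<^sup>2 * (m (\<lambda>x. (f x)\<^sup>2) - m (\<lambda>x. (f' x)\<^sup>2))"
  using assms(1-3)
proof (induction I arbitrary: f)
  case empty
  then show ?case by (intro exI[of _ f]) (auto simp: m.const)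
next
  case (insert i I)
  note f = insert.prems(1)
  have bf: "bfun f" by (rule almost_periodic_bfun[OF f])
  define g where "g = proj (h i) f"
  define d where "d x = f x - g x" for x
  have g: "almost_periodic g" unfolding g_def by (rule almost_periodic_proj[OF f])
  have d: "almost_periodic d" unfolding d_def by (intro almost_periodic_diff f g)
  have split: "corr f x = corr g x + corr d x" and d0: "proj (h i) d x = 0" for x
    using corr_split[OF f, where h = "h i" and x = x] unfolding g_def[symmetric] d_def[symmetric] by auto
  \<comment> \<open>Translations commute, so averaging along \<open>h i\<close> keeps the bound on
    the variation along the other \<open>h j\<close>.\<close>
  have small: "\<bar>g x - g (zmul k (h j) + x)\<bar> \<le> e" if "j \<in> I" for j k x
    unfolding g_def proj_def
  proof (intro l.abs_diff_le bfun_reparam[OF bf])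
    fix n
    show "\<bar>f (zmul n (h i) + x) - f (zmul n (h i) + (zmul k (h j) + x))\<bar> \<le> e"
      using insert.prems(2)[of j "zmul n (h i) + x" k] that by (simp add: add.left_commute)
  qed
  obtain f' where f': "almost_periodic f'"
    "\<forall>k. (\<forall>x. g (k + x) = g x) \<longrightarrow> (\<forall>x. f' (k + x) = f' x)"
    "\<forall>j\<in>I. \<forall>k x. f' (zmul k (h j) + x) = f' x"
    "m (\<lambda>x. (corr g x - corr f' x)\<^sup>2) \<le> e\<^sup>2 * (m (\<lambda>x. (g x)\<^sup>2) - m (\<lambda>x. (f' x)\<^sup>2))"
    using insert.IH[of g, OF g small] by blast
  have g_inv: "g (zmul k (h i) + x) = g x" for k x
    unfolding g_def by (rule proj_invariant[OF bf])
  have f'_inv: "f' (zmul k (h i) + x) = f' x" for k x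
    using f'(2) g_inv by blast
  \<comment> \<open>The error of the remaining averages. It is invariant under \<open>h i\<close>,
    hence orthogonal to \<open>corr d\<close>, which averages to 0 along \<open>h i\<close>.\<close>
  define r where "r x = corr g x - corr f' x" for x
  have r: "almost_periodic r"
    unfolding r_def by (intro almost_periodic_diff m.almost_periodic_autocorrelation g f')
  have r_inv: "r (zmul k (h i) + x) = r x" for k x
    by (simp add: r_def m.autocorrelation_def g_inv f'_inv add.assoc)
  have cd: "almost_periodic (corr d)" by (rule m.almost_periodic_autocorrelation[OF d])
  have "proj (h i) (corr d) x = 0" for x
    by (simp add: proj_corr[OF d] d0 m.const)
  then have orth: "m (\<lambda>x. corr d x * r x) = 0"
    using proj_adjoint[OF cd almost_periodic_bfun[OF r] r_inv] by (simp add: m.const)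
  have d2: "m (\<lambda>x. (d x)\<^sup>2) = m (\<lambda>x. (f x)\<^sup>2) - m (\<lambda>x. (g x)\<^sup>2)"
    using split[of 0] by (simp add: m.autocorrelation_0)
  have "\<bar>d x\<bar> \<le> e" for x
  proof -
    have "\<bar>l (\<lambda>_. f x) - l (\<lambda>k. f (zmul k (h i) + x))\<bar> \<le> e"
      by (intro l.abs_diff_le bfun_reparam[OF bf] bfun_const) (use insert.prems(2) in auto)
    then show ?thesis by (simp add: d_def g_def proj_def l.const)
  qed
  then have "(d x)\<^sup>2 \<le> e\<^sup>2" for x using abs_le_square_iff[of "d x" e] \<open>e \<ge> 0\<close> by simp
  then have d2e: "m (\<lambda>x. (d x)\<^sup>2) \<le> e\<^sup>2"
    using m.abs_le[of "\<lambda>x. (d x)\<^sup>2" "e\<^sup>2"] by simp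
  have d2n: "0 \<le> m (\<lambda>x. (d x)\<^sup>2)" by (intro m.nonneg bfun_power2 almost_periodic_intros d) simp
  \<comment> \<open>Of the two factors \<open>m (\<lambda>x. (d x)\<^sup>2)\<close>, one is
    estimated by \<open>e\<^sup>2\<close> and the other is kept for the telescoping.\<close>
  have "(corr d x)\<^sup>2 \<le> e\<^sup>2 * m (\<lambda>x. (d x)\<^sup>2)" for x
  proof -
    have "(corr d x)\<^sup>2 \<le> (m (\<lambda>x. (d x)\<^sup>2))\<^sup>2"
      using m.abs_autocorrelation_le[OF d, of x] d2n abs_le_square_iff[of "corr d x" "m (\<lambda>x. (d x)\<^sup>2)"] by simp
    also have "\<dots> \<le> e\<^sup>2 * m (\<lambda>x. (d x)\<^sup>2)"
      unfolding power2_eq_square[of "m _"] by (rule mult_right_mono[OF d2e d2n])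
    finally show ?thesis .
  qed
  then have cd2: "m (\<lambda>x. (corr d x)\<^sup>2) \<le> e\<^sup>2 * m (\<lambda>x. (d x)\<^sup>2)"
    using m.abs_le[of "\<lambda>x. (corr d x)\<^sup>2"] by (simp add: abs_le_iff)
  have "(\<lambda>x. (corr f x - corr f' x)\<^sup>2) = (\<lambda>x. ((corr d x)\<^sup>2 + (r x)\<^sup>2) + 2 * (corr d x * r x))"
    by (simp add: split r_def power2_eq_square algebra_simps)
  then have "m (\<lambda>x. (corr f x - corr f' x)\<^sup>2) = m (\<lambda>x. ((corr d x)\<^sup>2 + (r x)\<^sup>2) + 2 * (corr d x * r x))"
    by (rule arg_cong)
  also have "\<dots> = (m (\<lambda>x. (corr d x)\<^sup>2) + m (\<lambda>x. (r x)\<^sup>2)) + 2 * m (\<lambda>x. corr d x * r x)"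
    by (subst m.add m.scale, (intro bfun_add bfun_mult bfun_const bfun_power2 almost_periodic_intros cd r)+)+ simp
  also have "\<dots> \<le> e\<^sup>2 * m (\<lambda>x. (d x)\<^sup>2) + e\<^sup>2 * (m (\<lambda>x. (g x)\<^sup>2) - m (\<lambda>x. (f' x)\<^sup>2))"
    using cd2 f'(4)[folded r_def] orth by linarith
  also have "\<dots> = e\<^sup>2 * (m (\<lambda>x. (f x)\<^sup>2) - m (\<lambda>x. (f' x)\<^sup>2))"
    by (simp add: d2 algebra_simps)
  finally have bound: "m (\<lambda>x. (corr f x - corr f' x)\<^sup>2) \<le> e\<^sup>2 * (m (\<lambda>x. (f x)\<^sup>2) - m (\<lambda>x. (f' x)\<^sup>2))" .
  have "\<forall>k. (\<forall>x. f (k + x) = f x) \<longrightarrow> (\<forall>x. f' (k + x) = f' x)"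
  proof (intro allI impI)
    fix k x assume k: "\<forall>x. f (k + x) = f x"
    have "g (k + x) = g x" for x using k by (simp add: g_def proj_def add.left_commute[of _ k])
    then show "f' (k + x) = f' x" using f'(2) by blast
  qed
  moreover have "\<forall>j\<in>insert i I. \<forall>k x. f' (zmul k (h j) + x) = f' x"
    using f'(3) f'_inv by blast
  ultimately show ?case using f'(1) bound by blast
qed

end

text \<open>What matters is that \<open>e\<close> is chosen from \<open>f\<close> alone, before
  \<open>I\<close> and \<open>h\<close>.\<close>

lemma sum_in_support_differences:
  fixes f :: "'a::ab_group_add \<Rightarrow> real"
  assumes f: "almost_periodic f" and f0: "f 0 \<noteq> 0"
  shows "\<exists>e>0. \<forall>(I :: 'i set) h. finite I \<longrightarrow> (\<forall>i\<in>I. \<forall>k x. \<bar>f x - f (zmul k (h i) + x)\<bar> \<le> e) \<longrightarrow>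
    (\<exists>a b c d. f a \<noteq> 0 \<and> f b \<noteq> 0 \<and> f c \<noteq> 0 \<and> f d \<noteq> 0 \<and> (\<Sum>i\<in>I. h i) = (a - b) - (c - d))"
proof -
  obtain m :: "('a \<Rightarrow> real) \<Rightarrow> real" where "invariant_mean m" using invariant_mean_exists by blast
  moreover obtain l :: "(int \<Rightarrow> real) \<Rightarrow> real" where "invariant_mean l" using invariant_mean_exists by blast
  ultimately interpret invariant_mean_pair m l by (simp add: invariant_mean_pair_def)
  define p where "p = corr f"
  have p: "almost_periodic p" unfolding p_def by (rule m.almost_periodic_autocorrelation[OF f])
  have sq_pos: "0 < m (\<lambda>x. (u x)\<^sup>2)" if "almost_periodic u" "u 0 \<noteq> 0" for u
    using m.almost_periodic_pos[OF almost_periodic_mult[OF that(1,1)], of 0] that(2)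
    by (simp add: power2_eq_square zero_less_mult_iff linorder_neq_iff disj_commute)
  have f2: "0 < m (\<lambda>x. (f x)\<^sup>2)" by (rule sq_pos[of f, OF f f0])
  have "p 0 \<noteq> 0" using f2 by (simp add: p_def m.autocorrelation_0)
  then have p2: "0 < m (\<lambda>x. (p x)\<^sup>2)" by (rule sq_pos[of p, OF p])
  \<comment> \<open>With squared norms abbreviated \<open>|p|^2\<close>, this makes
    \<open>4 e^2 |f|^2 = |p|^2\<close>. If the product of \<open>p\<close> and its translate
    vanished, then \<open>2 |p|^2 \<le> 4 |r|^2 \<le> 4 e^2 |f|^2 = |p|^2\<close>, which contradicts
    \<open>p2\<close>.\<close>
  define e where "e = sqrt (m (\<lambda>x. (p x)\<^sup>2) / (4 * m (\<lambda>x. (f x)\<^sup>2)))"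
  have e: "e > 0" using f2 p2 by (simp add: e_def)
  have "e\<^sup>2 = m (\<lambda>x. (p x)\<^sup>2) / (4 * m (\<lambda>x. (f x)\<^sup>2))" unfolding e_def using f2 p2 by simp
  then have e2: "4 * (e\<^sup>2 * m (\<lambda>x. (f x)\<^sup>2)) = m (\<lambda>x. (p x)\<^sup>2)" using f2 by simp
  have "\<exists>a b c d. f a \<noteq> 0 \<and> f b \<noteq> 0 \<and> f c \<noteq> 0 \<and> f d \<noteq> 0 \<and> (\<Sum>i\<in>I. h i) = (a - b) - (c - d)"
    if I: "finite I" and h: "\<And>i k x. i \<in> I \<Longrightarrow> \<bar>f x - f (zmul k (h i) + x)\<bar> \<le> e" for I and h :: "'i \<Rightarrow> 'a"
  proof -
    have "\<exists>f'. almost_periodic f' \<and>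
      (\<forall>k. (\<forall>x. f (k + x) = f x) \<longrightarrow> (\<forall>x. f' (k + x) = f' x)) \<and>
      (\<forall>i\<in>I. \<forall>k x. f' (zmul k (h i) + x) = f' x) \<and>
      m (\<lambda>x. (corr f x - corr f' x)\<^sup>2) \<le> e\<^sup>2 * (m (\<lambda>x. (f x)\<^sup>2) - m (\<lambda>x. (f' x)\<^sup>2))"
      by (rule autocorrelation_approx[OF I f]) (use h e in auto)
    then obtain f' where f': "almost_periodic f'" and inv: "\<forall>i\<in>I. \<forall>k x. f' (zmul k (h i) + x) = f' x"
      and app: "m (\<lambda>x. (corr f x - corr f' x)\<^sup>2) \<le> e\<^sup>2 * (m (\<lambda>x. (f x)\<^sup>2) - m (\<lambda>x. (f' x)\<^sup>2))"
      by blast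
    define g where "g = (\<Sum>i\<in>I. h i)"
    have "f' ((\<Sum>i\<in>J. h i) + x) = f' x" if "J \<subseteq> I" for J x
      using finite_subset[OF that I] that
    proof (induction J)
      case (insert j J)
      then have "f' (zmul 1 (h j) + (sum h J + x)) = f' x" using inv by simp
      then show ?case using insert.hyps by (simp add: zmul_simps(2) add.assoc)
    qed simp
    then have g_inv: "f' (g + x) = f' x" for x unfolding g_def by blast
    define r where "r x = p x - corr f' x" for x
    have r: "almost_periodic r"
      unfolding r_def p_def by (intro almost_periodic_diff m.almost_periodic_autocorrelation f f')
    \<comment> \<open>The autocorrelation of \<open>f'\<close> is invariant under \<open>g\<close>
      and cancels; only the error \<open>r\<close> remains.\<close>
    have pr: "p x - p (g + x) = r x - r (g + x)" for x
      by (simp add: r_def m.autocorrelation_def g_inv add.assoc)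
    have bp: "bfun (\<lambda>x. (p x)\<^sup>2)" and br: "bfun (\<lambda>x. (r x)\<^sup>2)"
      by (intro bfun_power2 almost_periodic_bfun p r)+
    have bps: "bfun (\<lambda>x. (p (g + x))\<^sup>2)" and brs: "bfun (\<lambda>x. (r (g + x))\<^sup>2)"
      by (rule bfun_reparam[OF bp] bfun_reparam[OF br])+
    have shifts: "m (\<lambda>x. (p (g + x))\<^sup>2) = m (\<lambda>x. (p x)\<^sup>2)" "m (\<lambda>x. (r (g + x))\<^sup>2) = m (\<lambda>x. (r x)\<^sup>2)"
      using m.shift[OF bp, of g] m.shift[OF br, of g] by auto
    have "\<exists>x. p x * p (g + x) \<noteq> 0"
    proof (rule ccontr)
      assume "\<not> (\<exists>x. p x * p (g + x) \<noteq> 0)"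
      then have "p x * p (g + x) = 0" for x by blast
      then have sq: "(p x)\<^sup>2 + (p (g + x))\<^sup>2 = (p x - p (g + x))\<^sup>2" for x
        by (simp add: power2_diff mult.assoc)
      have "(p x)\<^sup>2 + (p (g + x))\<^sup>2 \<le> 2 * ((r x)\<^sup>2 + (r (g + x))\<^sup>2)" for x
        unfolding sq pr using zero_le_power2[of "r x + r (g + x)"] by (simp add: power2_sum power2_diff)
      then have "m (\<lambda>x. (p x)\<^sup>2 + (p (g + x))\<^sup>2) \<le> m (\<lambda>x. 2 * ((r x)\<^sup>2 + (r (g + x))\<^sup>2))"
        by (intro m.mono bfun_add bfun_mult bfun_const bp br bps brs)
      also have "\<dots> = 4 * m (\<lambda>x. (r x)\<^sup>2)"
        using m.scale[OF bfun_add[OF br brs], of 2] m.add[OF br brs] shifts by simp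
      finally have "2 * m (\<lambda>x. (p x)\<^sup>2) \<le> 4 * m (\<lambda>x. (r x)\<^sup>2)"
        using m.add[OF bp bps] shifts by simp
      also have "m (\<lambda>x. (r x)\<^sup>2) \<le> e\<^sup>2 * m (\<lambda>x. (f x)\<^sup>2)"
      proof -
        have "0 \<le> m (\<lambda>x. (f' x)\<^sup>2)" by (intro m.nonneg bfun_power2 almost_periodic_bfun f') simp
        then have "e\<^sup>2 * (m (\<lambda>x. (f x)\<^sup>2) - m (\<lambda>x. (f' x)\<^sup>2)) \<le> e\<^sup>2 * m (\<lambda>x. (f x)\<^sup>2)"
          by (intro mult_left_mono) auto
        then show ?thesis using app by (simp add: r_def p_def)
      qed
      finally show False using e2 p2 by simp
    qed
    then obtain x where x: "corr f x \<noteq> 0" "corr f (g + x) \<noteq> 0" unfolding p_def by auto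
    \<comment> \<open>Each of \<open>x\<close> and \<open>g + x\<close> is thereby a difference of
      two points of the support of \<open>f\<close>, and \<open>g\<close> is the difference of the
      two.\<close>
    have supp: "\<exists>y. f (z + y) \<noteq> 0 \<and> f y \<noteq> 0" if "corr f z \<noteq> 0" for z
    proof (rule ccontr)
      assume "\<not> ?thesis"
      then have eq: "f (z + y) * f y = 0" for y by simp
      show False using that unfolding m.autocorrelation_def eq m.const by simp
    qed
    obtain y where y: "f (g + x + y) \<noteq> 0" "f y \<noteq> 0" using supp[OF x(2)] by blast
    obtain z where z: "f (x + z) \<noteq> 0" "f z \<noteq> 0" using supp[OF x(1)] by blast
    have "(\<Sum>i\<in>I. h i) = ((g + x + y) - y) - ((x + z) - z)" by (simp add: g_def)
    then show ?thesis using y z by blast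
  qed
  then show ?thesis using e by (intro exI[of _ e] conjI allI impI) auto
qed

section \<open>Precompact groups\<close>

lemma uniformly_continuous_compact_group:
  fixes f :: "'k::topological_ab_group_add \<Rightarrow> real"
  assumes "compact (UNIV :: 'k set)" "continuous_on UNIV f" "e > 0"
  obtains V where "open V" "0 \<in> V" "\<And>v x. v \<in> V \<Longrightarrow> \<bar>f x - f (v + x)\<bar> \<le> e"
proof -
  have "continuous_on (UNIV \<times> UNIV) (\<lambda>(v, x). f (v + x))"
    unfolding case_prod_unfold
    by (intro continuous_on_compose2[OF assms(2)] continuous_intros) auto
  \<comment> \<open>The tube lemma: compactness in \<open>x\<close> makes continuity at
    \<open>v = 0\<close> uniform.\<close>
  then obtain V where "0 \<in> V" "open V" "\<forall>v\<in>V \<inter> UNIV. \<forall>x\<in>UNIV. dist (f (v + x)) (f (0 + x)) \<le> e"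
    by (rule continuous_on_prod_compactE[OF _ assms(1) _ assms(3), of UNIV _ 0]) auto
  then show ?thesis by (intro that[of V]) (auto simp: dist_real_def abs_minus_commute)
qed

lemma almost_periodic_compact_group:
  fixes f :: "'k::topological_ab_group_add \<Rightarrow> real"
  assumes K: "compact (UNIV :: 'k set)" and f: "continuous_on UNIV f"
  shows "almost_periodic f"
  unfolding almost_periodic_def
proof (rule totally_bounded_family_net)
  fix e :: real assume "e > 0"
  then obtain V where V: "open V" "0 \<in> V" "\<And>v x. v \<in> V \<Longrightarrow> \<bar>f x - f (v + x)\<bar> \<le> e"
    using uniformly_continuous_compact_group[OF K f] by blast
  have op: "open ((\<lambda>x. x - s) -` V)" if "s \<in> UNIV" for s :: 'k
    by (intro open_vimage V(1) continuous_intros)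
  have cov: "(UNIV :: 'k set) \<subseteq> (\<Union>s\<in>UNIV. (\<lambda>x. x - s) -` V)" using V(2) by auto
  obtain S :: "'k set" where "S \<subseteq> UNIV" and S: "finite S" "UNIV \<subseteq> (\<Union>s\<in>S. (\<lambda>x. x - s) -` V)"
    by (rule compactE_image[OF K op cov])
  have "\<exists>s\<in>S. \<forall>y. \<bar>f (x + y) - f (s + y)\<bar> \<le> e" for x
  proof -
    obtain s where s: "s \<in> S" "x - s \<in> V" using S(2) by blast
    have "\<bar>f (x + y) - f (s + y)\<bar> \<le> e" for y
      using V(3)[OF s(2), of "s + y"] by (simp add: abs_minus_commute)
    then show ?thesis using s(1) by blast
  qed
  then show "\<exists>S. finite S \<and> (\<forall>x. \<exists>s\<in>S. \<forall>y. \<bar>f (x + y) - f (s + y)\<bar> \<le> e)" using S(1) by blast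
qed

text \<open>A Urysohn function on the compact group is pulled back along the embedding. Almost
  periodicity and uniform continuity survive because the embedding is a continuous
  homomorphism.\<close>

lemma precompact_cutoff:
  fixes W :: "'a::{topological_ab_group_add, t2_space} set"
  assumes "precompact_in TYPE('k::{topological_ab_group_add, t2_space}) TYPE('a)" "open W" "0 \<in> W"
  obtains f where "almost_periodic f" "f 0 = (1::real)" "\<And>x. f x \<noteq> 0 \<Longrightarrow> x \<in> W"
    "\<And>e. e > 0 \<Longrightarrow> \<exists>V. open V \<and> 0 \<in> V \<and> (\<forall>v\<in>V. \<forall>x. \<bar>f x - f (v + x)\<bar> \<le> e)"
proof -
  obtain i :: "'a \<Rightarrow> 'k" where K: "compact (UNIV :: 'k set)"
    and add: "\<And>x y. i (x + y) = i x + i y" and emb: "embedding_map euclidean euclidean i"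
    using assms(1) unfolding precompact_in_def by blast
  have i0: "i 0 = 0" using add[of 0 0] by simp
  have hom: "homeomorphic_map euclidean (top_of_set (range i)) i"
    using emb by (simp add: embedding_map_def)
  have cont: "continuous_on UNIV i"
    using homeomorphic_imp_continuous_map[OF hom] by (simp add: continuous_map_in_subtopology)
  have inj: "inj i" using homeomorphic_imp_injective_map[OF hom] by simp
  \<comment> \<open>The image of \<open>W\<close> is open only relative to \<open>range i\<close>;
    Urysohn's lemma is applied to an open set \<open>O'\<close> of the whole group with this
    trace.\<close>
  have "openin (top_of_set (range i)) (i ` W)"
    using homeomorphic_imp_open_map[OF hom] \<open>open W\<close> by (simp add: open_map_def)
  then obtain O' where O': "open O'" "i ` W = range i \<inter> O'" by (auto simp: openin_open)
  have normal: "normal_space (euclidean :: 'k topology)"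
    by (rule compact_Hausdorff_or_regular_imp_normal_space)
      (use K in \<open>simp_all add: compact_space_def Hausdorff_space_def disjnt_def, metis hausdorff\<close>)
  have "0 \<in> O'" using O'(2) i0 assms(3) by (metis IntD2 imageI)
  then have dis: "disjnt (- O') {0}" by simp
  obtain f :: "'k \<Rightarrow> real" where f: "continuous_map euclidean euclideanreal f" "f ` (- O') \<subseteq> {0}" "f ` {0} \<subseteq> {1}"
    by (rule Urysohn_lemma_alt[OF normal _ _ dis]) (use O'(1) in auto)
  then have fc: "continuous_on UNIV f" by simp
  show ?thesis
  proof (rule that[of "\<lambda>x. f (i x)"])
    show "almost_periodic (\<lambda>x. f (i x))"
      using totally_bounded_family_reparam[OF almost_periodic_compact_group[OF K fc, unfolded almost_periodic_def], of i i]
      by (simp add: almost_periodic_def add)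
    show "f (i 0) = 1" using f(3) i0 by simp
    show "x \<in> W" if "f (i x) \<noteq> 0" for x
    proof -
      have "i x \<in> i ` W" using f(2) that O'(2) by auto
      then show ?thesis using inj by (simp add: inj_image_mem_iff)
    qed
    fix e :: real assume "e > 0"
    then obtain V where V: "open V" "0 \<in> V" "\<And>v x. v \<in> V \<Longrightarrow> \<bar>f x - f (v + x)\<bar> \<le> e"
      using uniformly_continuous_compact_group[OF K fc] by blast
    have "open (i -` V)" by (rule open_vimage[OF V(1) cont])
    then show "\<exists>V. open V \<and> 0 \<in> V \<and> (\<forall>v\<in>V. \<forall>x. \<bar>f (i x) - f (i (v + x))\<bar> \<le> e)"
      using V i0 by (intro exI[of _ "i -` V"]) (auto simp: add)
  qed
qed

section \<open>Neighbourhoods of zero in a precompact group\<close>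

lemma nhd_0_halve:
  fixes W :: "'a::topological_ab_group_add set"
  assumes "open W" "0 \<in> W"
  obtains V where "open V" "0 \<in> V" "\<And>a b. a \<in> V \<Longrightarrow> b \<in> V \<Longrightarrow> a - b \<in> W"
    "\<And>a b. a \<in> V \<Longrightarrow> b \<in> V \<Longrightarrow> a + b \<in> W"
proof -
  have "open ((\<lambda>p. fst p - snd p) -` W \<inter> (\<lambda>p. fst p + snd p) -` W)"
    by (intro open_Int open_vimage assms(1) continuous_intros)
  moreover have "(0, 0) \<in> (\<lambda>p. fst p - snd p) -` W \<inter> (\<lambda>p. fst p + snd p) -` W" using assms(2) by simp
  ultimately obtain A B where "open A" "open B" "(0, 0) \<in> A \<times> B"
    "A \<times> B \<subseteq> (\<lambda>p. fst p - snd p) -` W \<inter> (\<lambda>p. fst p + snd p) -` W"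
    unfolding open_prod_def by meson
  then show ?thesis by (intro that[of "A \<inter> B"]) auto
qed

text \<open>This takes the place of characters. A cutoff supported in \<open>W2\<close>, where
  \<open>(W2 - W2) - (W2 - W2)\<close> lies in \<open>W\<close>, yields \<open>e\<close>, and
  uniform continuity yields \<open>V\<close>: if all multiples of \<open>h i\<close> lie in
  \<open>V\<close>, the cutoff varies by at most \<open>e\<close> along them.\<close>

lemma precompact_small_subgroups_sum:
  fixes W :: "'a::{topological_ab_group_add, t2_space} set"
  assumes pc: "precompact_in TYPE('k::{topological_ab_group_add, t2_space}) TYPE('a)" and W: "open W" "0 \<in> W"
  shows "\<exists>V. open V \<and> 0 \<in> V \<and>
    (\<forall>(I :: 'i set) h. finite I \<longrightarrow> (\<forall>i\<in>I. \<forall>k. zmul k (h i) \<in> V) \<longrightarrow> (\<Sum>i\<in>I. h i) \<in> W)"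
proof -
  obtain W1 where W1: "open W1" "0 \<in> W1" "\<And>a b. a \<in> W1 \<Longrightarrow> b \<in> W1 \<Longrightarrow> a - b \<in> W"
    by (rule nhd_0_halve[OF W]) (rule that; assumption)
  obtain W2 where W2: "open W2" "0 \<in> W2" "\<And>a b. a \<in> W2 \<Longrightarrow> b \<in> W2 \<Longrightarrow> a - b \<in> W1"
    by (rule nhd_0_halve[OF W1(1,2)]) (rule that; assumption)
  obtain f where f: "almost_periodic f" "f 0 = (1::real)" "\<And>x. f x \<noteq> 0 \<Longrightarrow> x \<in> W2"
    and uc: "\<And>e. e > 0 \<Longrightarrow> \<exists>V. open V \<and> 0 \<in> V \<and> (\<forall>v\<in>V. \<forall>x. \<bar>f x - f (v + x)\<bar> \<le> e)"
    by (rule precompact_cutoff[OF pc W2(1,2)]) (rule that; assumption)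
  have "f 0 \<noteq> 0" using f(2) by simp
  obtain e where e: "e > 0"
    "\<forall>(I :: 'i set) h. finite I \<longrightarrow> (\<forall>i\<in>I. \<forall>k x. \<bar>f x - f (zmul k (h i) + x)\<bar> \<le> e) \<longrightarrow>
    (\<exists>a b c d. f a \<noteq> 0 \<and> f b \<noteq> 0 \<and> f c \<noteq> 0 \<and> f d \<noteq> 0 \<and> (\<Sum>i\<in>I. h i) = (a - b) - (c - d))"
    using sum_in_support_differences[OF f(1) \<open>f 0 \<noteq> 0\<close>, where 'i = 'i] by (elim exE conjE)
  obtain V where V: "open V" "0 \<in> V" "\<forall>v\<in>V. \<forall>x. \<bar>f x - f (v + x)\<bar> \<le> e"
    using uc[OF e(1)] by (elim exE conjE)
  have "(\<Sum>i\<in>I. h i) \<in> W" if I: "finite I" and h: "\<forall>i\<in>I. \<forall>k. zmul k (h i) \<in> V"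
    for I and h :: "'i \<Rightarrow> 'a"
  proof -
    have "\<forall>i\<in>I. \<forall>k x. \<bar>f x - f (zmul k (h i) + x)\<bar> \<le> e" using V(3) h by blast
    with e(2) I have "\<exists>a b c d. f a \<noteq> 0 \<and> f b \<noteq> 0 \<and> f c \<noteq> 0 \<and> f d \<noteq> 0 \<and> (\<Sum>i\<in>I. h i) = (a - b) - (c - d)"
      by blast
    then obtain a b c d where abcd: "f a \<noteq> 0" "f b \<noteq> 0" "f c \<noteq> 0" "f d \<noteq> 0"
      and eq: "(\<Sum>i\<in>I. h i) = (a - b) - (c - d)" by blast
    show ?thesis unfolding eq by (intro W1(3) W2(3) f(3) abcd)
  qed
  then show ?thesis using V(1,2) by blast
qed

lemma precompact_finite_cover:
  fixes W :: "'a::{topological_ab_group_add, t2_space} set"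
  assumes pc: "precompact_in TYPE('k::{topological_ab_group_add, t2_space}) TYPE('a)" and W: "open W" "0 \<in> W"
  obtains c :: "'a \<Rightarrow> nat" where "finite (range c)" "\<And>x y. c x = c y \<Longrightarrow> x - y \<in> W"
proof -
  obtain f where f: "almost_periodic f" "f 0 = (1::real)" "\<And>x. f x \<noteq> 0 \<Longrightarrow> x \<in> W"
    by (rule precompact_cutoff[OF assms]) (rule that; assumption)
  have "(1::real) / 2 > 0" by simp
  then obtain c :: "'a \<Rightarrow> nat" where c: "finite (range c)"
    "\<And>x y z. c x = c y \<Longrightarrow> \<bar>f (x + z) - f (y + z)\<bar> \<le> 1 / 2"
    using f(1) unfolding almost_periodic_def totally_bounded_family_def by blast
  have "x - y \<in> W" if "c x = c y" for x y
    \<comment> \<open>The shift by \<open>- y\<close> compares \<open>f (x - y)\<close> with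
      \<open>f 0 = 1\<close>; a gap of at most 1/2 keeps it nonzero.\<close>
    using c(2)[OF that, of "- y"] f(2) by (intro f(3)) (auto simp: abs_le_iff)
  then show ?thesis using c(1) that by blast
qed

section \<open>Direct sums\<close>

lemma zmul_mult: "zmul k (zmul z a) = zmul (k * z) a"
proof (induction k rule: int_induct[where k = 0])
  case base
  then show ?case by (simp add: zmul_simps(1))
next
  case (step1 k)
  then show ?case by (simp add: zmul_simps(2,3) algebra_simps)
next
  case (step2 k)
  then show ?case by (simp add: zmul_diff zmul_simps(2) algebra_simps)
qed

lemma zmul_minus: "zmul (- z) a = - zmul z a"
  using zmul_diff[of 0 z a] by (simp add: zmul_simps(1))

lemma direct_sum_coord:
  assumes "x \<in> direct_sum A" "a \<in> A"
  obtains z where "x a = zmul z a"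
  using assms by (auto simp: direct_sum_def PiE_def Pi_def group_closure_singleton image_iff)

lemma direct_sum_eqI:
  assumes "x \<in> direct_sum A" "y \<in> direct_sum A" "\<And>a. a \<in> A \<Longrightarrow> x a = y a"
  shows "x = y"
  using assms by (auto simp: direct_sum_def intro: PiE_ext)

lemma direct_sum_diff:
  assumes x: "x \<in> direct_sum A" and y: "y \<in> direct_sum A"
  shows "(\<lambda>a\<in>A. x a - y a) \<in> direct_sum A"
    and "direct_sum_map A (\<lambda>a\<in>A. x a - y a) = direct_sum_map A x - direct_sum_map A y"
proof -
  let ?d = "\<lambda>a\<in>A. x a - y a"
  have "{a \<in> A. ?d a \<noteq> 0} \<subseteq> {a \<in> A. x a \<noteq> 0} \<union> {a \<in> A. y a \<noteq> 0}" by auto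
  then have "finite {a \<in> A. ?d a \<noteq> 0}"
    by (rule finite_subset) (use x y in \<open>simp add: direct_sum_def\<close>)
  then show d: "?d \<in> direct_sum A"
    using x y by (auto simp: direct_sum_def PiE_def Pi_def intro: group_closure.diff)
  have "(\<lambda>a\<in>A. ?d a + y a) = x"
    using x by (auto simp: direct_sum_def fun_eq_iff PiE_def extensional_def)
  then show "direct_sum_map A ?d = direct_sum_map A x - direct_sum_map A y"
    using direct_sum_map_add[OF d y] by simp
qed

lemma direct_sum_family:
  fixes z :: "'a::ab_group_add \<Rightarrow> int"
  assumes "finite B" "B \<subseteq> A"
  defines "x \<equiv> \<lambda>a\<in>A. if a \<in> B then zmul (z a) a else 0"
  shows "x \<in> direct_sum A" and "direct_sum_map A x = (\<Sum>a\<in>B. zmul (z a) a)"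
proof -
  have "{a \<in> A. x a \<noteq> 0} \<subseteq> B" by (auto simp: x_def)
  then have "finite {a \<in> A. x a \<noteq> 0}" using assms(1) by (rule finite_subset)
  moreover have "0 \<in> group_closure {a}" for a :: 'a
    unfolding group_closure_singleton using zmul_simps(1)[of a] by (metis rangeI)
  ultimately show "x \<in> direct_sum A"
    unfolding direct_sum_def by (auto simp: x_def group_closure_singleton)
  have "direct_sum_map A x = (\<Sum>a\<in>B. x a)"
    by (rule direct_sum_map_eq[OF assms(1,2)]) (auto simp: x_def)
  also have "\<dots> = (\<Sum>a\<in>B. zmul (z a) a)" using assms(2) by (intro sum.cong) (auto simp: x_def)
  finally show "direct_sum_map A x = (\<Sum>a\<in>B. zmul (z a) a)" .
qed

text \<open>Integer families on finite sets represent the elements of the direct sum, and both sides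
  depend on the multiples \<open>zmul (z a) a\<close> only. In this form independence is a uniform
  continuity at 0 of the inverse of the summation map.\<close>

lemma topologically_independent_iff:
  assumes "0 \<notin> A"
  shows "topologically_independent A \<longleftrightarrow>
    (\<forall>W. open W \<longrightarrow> 0 \<in> W \<longrightarrow> (\<exists>U. open U \<and> 0 \<in> U \<and>
      (\<forall>x\<in>direct_sum A. direct_sum_map A x \<in> U \<longrightarrow> (\<forall>a\<in>A. x a \<in> W))))"
    (is "?L \<longleftrightarrow> ?R")
proof
  assume L: ?L
  show ?R
  proof (intro allI impI)
    fix W :: "'a set" assume W: "open W" "0 \<in> W"
    then obtain U where U: "0 \<in> interior U"
      and ind: "\<forall>B z. finite B \<and> B \<subseteq> A \<and> (\<Sum>a\<in>B. zmul (z a) a) \<in> U \<longrightarrow> (\<forall>a\<in>B. zmul (z a) a \<in> W)"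
      using L interior_open[OF W(1)] unfolding topologically_independent_def by blast
    have "x a \<in> W" if x: "x \<in> direct_sum A" and xU: "direct_sum_map A x \<in> interior U" and a: "a \<in> A" for x a
    \<comment> \<open>A zero coordinate is not in the support \<open>B\<close> to which independence
      is applied, but 0 lies in \<open>W\<close> anyway.\<close>
    proof (cases "x a = 0")
      case False
      have "\<forall>b\<in>A. \<exists>z. x b = zmul z b" using direct_sum_coord[OF x] by blast
      then obtain z where z: "\<forall>b\<in>A. x b = zmul (z b) b" by metis
      define B where "B = {b \<in> A. x b \<noteq> 0}"
      have B: "finite B" "B \<subseteq> A" "a \<in> B" using x a False by (auto simp: B_def direct_sum_def)
      have "direct_sum_map A x = (\<Sum>b\<in>B. zmul (z b) b)"
        unfolding direct_sum_map_def B_def using z by (intro sum.cong) auto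
      then have "(\<Sum>b\<in>B. zmul (z b) b) \<in> U" using xU interior_subset by auto
      then have "zmul (z a) a \<in> W" using ind B by blast
      then show ?thesis using z a by simp
    qed (use W in simp)
    then show "\<exists>U. open U \<and> 0 \<in> U \<and> (\<forall>x\<in>direct_sum A. direct_sum_map A x \<in> U \<longrightarrow> (\<forall>a\<in>A. x a \<in> W))"
      using U by (intro exI[of _ "interior U"]) auto
  qed
next
  assume R: ?R
  have "\<exists>U. 0 \<in> interior U \<and> (\<forall>B z. finite B \<and> B \<subseteq> A \<and> (\<Sum>a\<in>B. zmul (z a) a) \<in> U \<longrightarrow> (\<forall>a\<in>B. zmul (z a) a \<in> W))"
    if W: "0 \<in> interior W" for W
  proof -
    obtain U where U: "open U" "0 \<in> U"
      "\<forall>x\<in>direct_sum A. direct_sum_map A x \<in> U \<longrightarrow> (\<forall>a\<in>A. x a \<in> interior W)"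
      using R W open_interior by blast
    have "zmul (z a) a \<in> W" if B: "finite B" "B \<subseteq> A" "(\<Sum>a\<in>B. zmul (z a) a) \<in> U" "a \<in> B" for B z a
    proof -
      define x where "x = (\<lambda>a\<in>A. if a \<in> B then zmul (z a) a else 0)"
      have "x \<in> direct_sum A" "direct_sum_map A x \<in> U"
        using direct_sum_family[OF B(1,2), of z] B(3) by (simp_all add: x_def)
      then have "x a \<in> interior W" using U(3) B(2,4) by blast
      then have "x a \<in> W" using interior_subset by blast
      moreover have "x a = zmul (z a) a" using B(2,4) by (auto simp: x_def)
      ultimately show ?thesis by simp
    qed
    then show ?thesis using U(1,2) by (intro exI[of _ U]) (auto simp: interior_open)
  qed
  then show ?L
    unfolding topologically_independent_def by (intro conjI allI impI assms) simp_all
qed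

section \<open>A neighbourhood base of the direct sum\<close>

lemma openin_direct_sum_basic:
  assumes "finite F" "F \<subseteq> A" "open W" "x \<in> direct_sum A"
  shows "openin (direct_sum_topology A) {y \<in> direct_sum A. \<forall>a\<in>F. y a - x a \<in> W}"
  using assms(1,2)
proof (induction F)
  case empty
  then show ?case using openin_topspace[of "direct_sum_topology A"] by (simp add: topspace_direct_sum_topology)
next
  case (insert b F)
  have b: "b \<in> A" using insert by simp
  have "continuous_map (direct_sum_topology A) (top_of_set (group_closure {b})) (\<lambda>y. y b)"
    unfolding direct_sum_topology_def
    by (intro continuous_map_from_subtopology continuous_map_product_projection[OF b])
  then have "continuous_map (direct_sum_topology A) euclidean (\<lambda>y. y b)"
    by (rule continuous_map_into_fulltopology)
  moreover have "open ((\<lambda>w. w - x b) -` W)"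
    by (intro open_vimage assms(3) continuous_intros)
  ultimately have "openin (direct_sum_topology A) {y \<in> direct_sum A. y b \<in> (\<lambda>w. w - x b) -` W}"
    using openin_continuous_map_preimage[of "direct_sum_topology A" euclidean "\<lambda>y. y b" "(\<lambda>w. w - x b) -` W"]
    by (simp add: topspace_direct_sum_topology)
  moreover have "openin (direct_sum_topology A) {y \<in> direct_sum A. \<forall>a\<in>F. y a - x a \<in> W}"
    using insert by simp
  ultimately have "openin (direct_sum_topology A)
     ({y \<in> direct_sum A. y b \<in> (\<lambda>w. w - x b) -` W} \<inter> {y \<in> direct_sum A. \<forall>a\<in>F. y a - x a \<in> W})"
    by (rule openin_Int)
  also have "\<dots> = {y \<in> direct_sum A. \<forall>a\<in>insert b F. y a - x a \<in> W}" by auto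
  finally show ?case .
qed

lemma openin_direct_sum_topologyE:
  assumes O': "openin (direct_sum_topology A) O'" and x: "x \<in> O'"
  obtains F W where "finite F" "F \<subseteq> A" "open W" "0 \<in> W"
    "\<forall>y\<in>direct_sum A. (\<forall>a\<in>F. y a - x a \<in> W) \<longrightarrow> y \<in> O'"
proof -
  obtain S where S: "openin (product_topology (\<lambda>a. top_of_set (group_closure {a})) A) S"
    and O'S: "O' = S \<inter> direct_sum A"
    using O' unfolding direct_sum_topology_def openin_subtopology by blast
  have "x \<in> S" using x O'S by simp
  then obtain U where U: "finite {a \<in> A. U a \<noteq> group_closure {a}}"
    "\<forall>a\<in>A. openin (top_of_set (group_closure {a})) (U a)" "x \<in> Pi\<^sub>E A U" "Pi\<^sub>E A U \<subseteq> S"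
    using S unfolding openin_product_topology_alt by force
  define F where "F = {a \<in> A. U a \<noteq> group_closure {a}}"
  obtain T where T: "\<And>a. a \<in> A \<Longrightarrow> open (T a) \<and> U a = group_closure {a} \<inter> T a"
    using U(2) unfolding openin_open by metis
  \<comment> \<open>Translating every \<open>T a\<close> to 0 and intersecting over the finite set
    \<open>F\<close> gives one neighbourhood that serves all restricted coordinates.\<close>
  define W where "W = (\<Inter>a\<in>F. (\<lambda>w. w + x a) -` T a)"
  have xT: "x a \<in> T a" if "a \<in> A" for a using U(3) T[OF that] that by (auto simp: PiE_def Pi_def)
  show ?thesis
  proof (rule that[of F W])
    show F: "finite F" "F \<subseteq> A" using U(1) by (auto simp: F_def)
    show "open W" unfolding W_def
      using F T by (intro open_INT ballI open_vimage continuous_intros) auto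
    show "0 \<in> W" using xT F by (auto simp: W_def)
    have "y \<in> O'" if y: "y \<in> direct_sum A" and yx: "\<And>a. a \<in> F \<Longrightarrow> y a - x a \<in> W" for y
    proof -
      have yc: "y a \<in> group_closure {a}" if "a \<in> A" for a
        using y that by (auto simp: direct_sum_def PiE_def Pi_def)
      have "y a \<in> U a" if a: "a \<in> A" for a
      proof (cases "a \<in> F")
        case True
        then have "y a - x a \<in> (\<lambda>w. w + x a) -` T a" using yx[OF True] unfolding W_def by blast
        then show ?thesis using T[OF a] yc[OF a] by simp
      next
        case False
        then show ?thesis using a yc[OF a] by (simp add: F_def)
      qed
      moreover have "y \<in> extensional A" using y by (auto simp: direct_sum_def PiE_def)
      ultimately have "y \<in> Pi\<^sub>E A U" by (auto simp: PiE_def)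
      then show "y \<in> O'" using U(4) O'S y by blast
    qed
    then show "\<forall>y\<in>direct_sum A. (\<forall>a\<in>F. y a - x a \<in> W) \<longrightarrow> y \<in> O'" by blast
  qed
qed

section \<open>Continuity of the summation map at zero\<close>

lemma sum_nhd_0:
  fixes W :: "'a::topological_ab_group_add set"
  assumes "finite F" "open W" "0 \<in> W"
  shows "\<exists>V. open V \<and> 0 \<in> V \<and> (\<forall>y. (\<forall>a\<in>F. y a \<in> V) \<longrightarrow> (\<Sum>a\<in>F. y a) \<in> W)"
  using assms
proof (induction F arbitrary: W)
  case empty
  then show ?case by auto
next
  case (insert b F)
  obtain W1 where W1: "open W1" "0 \<in> W1" "\<And>a b. a \<in> W1 \<Longrightarrow> b \<in> W1 \<Longrightarrow> a + b \<in> W"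
    by (rule nhd_0_halve[OF insert.prems]) (rule that; assumption)
  obtain V where V: "open V" "0 \<in> V" "\<forall>y. (\<forall>a\<in>F. y a \<in> V) \<longrightarrow> (\<Sum>a\<in>F. y a) \<in> W1"
    using insert.IH[OF W1(1,2)] by (elim exE conjE)
  have "(\<Sum>a\<in>insert b F. y a) \<in> W" if "\<forall>a\<in>insert b F. y a \<in> V \<inter> W1" for y
    using that V(3) W1(3) insert.hyps by auto
  then show ?case using V W1 by (intro exI[of _ "V \<inter> W1"]) (auto intro: open_Int)
qed

text \<open>Pigeonhole: of infinitely many multiples outside \<open>V\<close>, two share a colour,
  so their difference lies in \<open>U\<close>. Independence of this pair then forces them into
  \<open>V\<close>.\<close>

lemma independent_almost_all_small:
  fixes A :: "'a::{topological_ab_group_add, t2_space} set"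
  assumes pc: "precompact_in TYPE('k::{topological_ab_group_add, t2_space}) TYPE('a)"
    and ind: "topologically_independent A" and V: "open V" "0 \<in> V"
  shows "finite {a \<in> A. \<exists>k. zmul k a \<notin> V}" (is "finite ?F")
proof (rule ccontr)
  assume inf: "infinite ?F"
  obtain U where U: "0 \<in> interior U"
    and indU: "\<forall>B z. finite B \<and> B \<subseteq> A \<and> (\<Sum>a\<in>B. zmul (z a) a) \<in> U \<longrightarrow> (\<forall>a\<in>B. zmul (z a) a \<in> V)"
    using ind V interior_open[OF V(1)] unfolding topologically_independent_def by blast
  obtain c :: "'a \<Rightarrow> nat" where c: "finite (range c)" "\<And>x y. c x = c y \<Longrightarrow> x - y \<in> interior U"
    by (rule precompact_finite_cover[OF pc open_interior U]) (rule that; assumption)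
  have "\<forall>a\<in>?F. \<exists>k. zmul k a \<notin> V" by blast
  then obtain k where k: "\<forall>a\<in>?F. zmul (k a) a \<notin> V" by (rule bchoice[THEN exE])
  have "finite ((\<lambda>a. c (zmul (k a) a)) ` ?F)" using c(1) by (rule finite_subset[rotated]) auto
  then have "\<not> inj_on (\<lambda>a. c (zmul (k a) a)) ?F" using inf finite_imageD by blast
  then obtain a b where ab: "a \<in> ?F" "b \<in> ?F" "a \<noteq> b" "c (zmul (k a) a) = c (zmul (k b) b)"
    unfolding inj_on_def by blast
  define z where "z e = (if e = a then k a else - k b)" for e
  have "zmul (k a) a - zmul (k b) b \<in> U" using c(2)[OF ab(4)] interior_subset by blast
  then have "(\<Sum>e\<in>{a, b}. zmul (z e) e) \<in> U" using ab(3) by (simp add: z_def zmul_minus)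
  then have "finite {a, b} \<and> {a, b} \<subseteq> A \<and> (\<Sum>e\<in>{a, b}. zmul (z e) e) \<in> U" using ab(1,2) by simp
  then have "\<forall>e\<in>{a, b}. zmul (z e) e \<in> V" by (rule indU[THEN spec, THEN spec, THEN mp])
  then have "zmul (k a) a \<in> V" by (simp add: z_def)
  then show False using k ab(1) by blast
qed

text \<open>All but finitely many \<open><a>\<close> lie in a neighbourhood for which
  \<open>precompact_small_subgroups_sum\<close> controls sums of any length. The finitely many other
  coordinates are handled by continuity of addition.\<close>

lemma independent_direct_sum_map_small:
  fixes A :: "'a::{topological_ab_group_add, t2_space} set"
  assumes pc: "precompact_in TYPE('k::{topological_ab_group_add, t2_space}) TYPE('a)"
    and ind: "topologically_independent A" and W: "open W" "0 \<in> W"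
  shows "\<exists>F V. finite F \<and> F \<subseteq> A \<and> open V \<and> 0 \<in> V \<and>
    (\<forall>y\<in>direct_sum A. (\<forall>a\<in>F. y a \<in> V) \<longrightarrow> direct_sum_map A y \<in> W)"
proof -
  obtain W1 where W1: "open W1" "0 \<in> W1" "\<And>a b. a \<in> W1 \<Longrightarrow> b \<in> W1 \<Longrightarrow> a + b \<in> W"
    by (rule nhd_0_halve[OF W]) (rule that; assumption)
  obtain V where V: "open V" "0 \<in> V"
    "\<forall>(I :: 'a set) h. finite I \<longrightarrow> (\<forall>i\<in>I. \<forall>k. zmul k (h i) \<in> V) \<longrightarrow> (\<Sum>i\<in>I. h i) \<in> W1"
    using precompact_small_subgroups_sum[OF pc W1(1,2), where 'i = 'a] by (elim exE conjE)
  define F where "F = {a \<in> A. \<exists>k. zmul k a \<notin> V}"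
  have F: "finite F" "F \<subseteq> A"
    using independent_almost_all_small[OF pc ind V(1,2)] by (auto simp: F_def)
  obtain V' where V': "open V'" "0 \<in> V'" "\<forall>y. (\<forall>a\<in>F. y a \<in> V') \<longrightarrow> (\<Sum>a\<in>F. y a) \<in> W1"
    using sum_nhd_0[OF F(1) W1(1,2)] by (elim exE conjE)
  have "direct_sum_map A y \<in> W" if y: "y \<in> direct_sum A" and yF: "\<forall>a\<in>F. y a \<in> V'" for y
  proof -
    define B where "B = {a \<in> A. y a \<noteq> 0}"
    have B: "finite B" "B \<subseteq> A" using y by (auto simp: B_def direct_sum_def)
    have "direct_sum_map A y = (\<Sum>a\<in>F \<union> (B - F). y a)"
      by (rule direct_sum_map_eq) (use F B in \<open>auto simp: B_def\<close>)
    also have "\<dots> = (\<Sum>a\<in>F. y a) + (\<Sum>a\<in>B - F. y a)"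
      using F B by (intro sum.union_disjoint) auto
    also have "\<dots> \<in> W"
    proof (rule W1(3))
      show "(\<Sum>a\<in>F. y a) \<in> W1" using V'(3) yF by blast
      \<comment> \<open>Multiples of the coordinate \<open>y a\<close> are multiples of
        \<open>a\<close>, and for \<open>a\<close> outside \<open>F\<close> all of these lie in
        \<open>V\<close>.\<close>
      have "zmul k (y a) \<in> V" if a: "a \<in> B - F" for a k
      proof -
        have "a \<in> A" using a B by blast
        then obtain z where "y a = zmul z a" using direct_sum_coord[OF y] by blast
        then show ?thesis using a B by (auto simp: zmul_mult F_def)
      qed
      then show "(\<Sum>a\<in>B - F. y a) \<in> W1" using V(3) B(1) by blast
    qed
    finally show ?thesis .
  qed
  then show ?thesis using F V'(1,2) by blast
qed

section \<open>The two implications\<close>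

lemma independent_imp_tychonoff_direct_sum:
  fixes A :: "'a::{topological_ab_group_add, t2_space} set"
  assumes pc: "precompact_in TYPE('k::{topological_ab_group_add, t2_space}) TYPE('a)"
    and ind: "topologically_independent A"
  shows "tychonoff_direct_sum A"
proof -
  let ?K = "direct_sum_map A" and ?D = "direct_sum A" and ?T = "direct_sum_topology A"
  have "0 \<notin> A" using ind by (simp add: topologically_independent_def)
  note ind' = ind[unfolded topologically_independent_iff[OF this], rule_format]
  have inj: "inj_on ?K ?D"
  proof (rule inj_onI)
    fix x y assume x: "x \<in> ?D" and y: "y \<in> ?D" and eq: "?K x = ?K y"
    have K0: "?K (\<lambda>a\<in>A. x a - y a) = 0" using direct_sum_diff(2)[OF x y] eq by simp
    show "x = y"
    proof (rule direct_sum_eqI[OF x y], rule ccontr)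
      fix a assume a: "a \<in> A" and "x a \<noteq> y a"
      then have "0 \<noteq> x a - y a" by simp
      \<comment> \<open>Independence puts all coordinates of a kernel element into every
        neighbourhood of 0, which the Hausdorff property forbids for a nonzero one.\<close>
      then obtain W where W: "open W" "0 \<in> W" "x a - y a \<notin> W" using separation_t1 by metis
      obtain U where "0 \<in> U" "\<forall>x\<in>?D. ?K x \<in> U \<longrightarrow> (\<forall>a\<in>A. x a \<in> W)"
        using ind'[OF W(1,2)] by blast
      then have "(\<lambda>a\<in>A. x a - y a) a \<in> W" using direct_sum_diff(1)[OF x y] K0 a by metis
      then show False using W(3) a by simp
    qed
  qed
  have cont: "continuous_map ?T euclidean ?K"
    unfolding continuous_map_def
  proof (intro conjI allI impI)
    fix O' :: "'a set" assume "openin euclidean O'"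
    then have O': "open O'" by simp
    show "openin ?T {x \<in> topspace ?T. ?K x \<in> O'}"
    proof (subst openin_subopen, intro ballI)
      fix x assume "x \<in> {x \<in> topspace ?T. ?K x \<in> O'}"
      then have x: "x \<in> ?D" "?K x \<in> O'" by (auto simp: topspace_direct_sum_topology)
      \<comment> \<open>Continuity at \<open>x\<close> is reduced to continuity at 0 by
        translation.\<close>
      have W: "open ((\<lambda>w. w + ?K x) -` O')" "0 \<in> (\<lambda>w. w + ?K x) -` O'"
        using x(2) by (auto intro!: open_vimage O' continuous_intros)
      obtain F V where F: "finite F" "F \<subseteq> A" and V: "open V" "0 \<in> V"
        and FV: "\<forall>y\<in>?D. (\<forall>a\<in>F. y a \<in> V) \<longrightarrow> ?K y \<in> (\<lambda>w. w + ?K x) -` O'"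
        using independent_direct_sum_map_small[OF pc ind W] by (elim exE conjE)
      let ?N = "{y \<in> ?D. \<forall>a\<in>F. y a - x a \<in> V}"
      have "openin ?T ?N" by (rule openin_direct_sum_basic[OF F V(1) x(1)])
      moreover have "x \<in> ?N" using x V(2) by simp
      moreover have "?K y \<in> O'" if y: "y \<in> ?D" "\<forall>a\<in>F. y a - x a \<in> V" for y
      proof -
        have "?K (\<lambda>a\<in>A. y a - x a) \<in> (\<lambda>w. w + ?K x) -` O'"
          using FV direct_sum_diff(1)[OF y(1) x(1)] y(2) F(2) by (auto simp: subset_iff)
        then show ?thesis by (simp add: direct_sum_diff(2)[OF y(1) x(1)])
      qed
      then have "?N \<subseteq> {x \<in> topspace ?T. ?K x \<in> O'}" by (auto simp: topspace_direct_sum_topology)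
      ultimately show "\<exists>T. openin ?T T \<and> x \<in> T \<and> T \<subseteq> {x \<in> topspace ?T. ?K x \<in> O'}" by blast
    qed
  qed simp
  have "homeomorphic_map ?T (top_of_set (?K ` ?D)) ?K"
  proof (rule bijective_open_imp_homeomorphic_map)
    show "continuous_map ?T (top_of_set (?K ` ?D)) ?K"
      using cont by (simp add: continuous_map_in_subtopology topspace_direct_sum_topology)
    show "open_map ?T (top_of_set (?K ` ?D)) ?K"
      unfolding open_map_def
    proof (intro allI impI)
      fix O' assume O': "openin ?T O'"
      then have O'D: "O' \<subseteq> ?D" using openin_subset topspace_direct_sum_topology by metis
      show "openin (top_of_set (?K ` ?D)) (?K ` O')"
      proof (subst openin_subopen, intro ballI)
        fix p assume "p \<in> ?K ` O'"
        then obtain x where x: "x \<in> O'" "p = ?K x" by blast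
        have xD: "x \<in> ?D" using x O'D by blast
        obtain F W where FW: "finite F" "F \<subseteq> A" "open W" "0 \<in> W"
          "\<forall>y\<in>?D. (\<forall>a\<in>F. y a - x a \<in> W) \<longrightarrow> y \<in> O'"
          by (rule openin_direct_sum_topologyE[OF O' x(1)]) (rule that; assumption)
        \<comment> \<open>Openness comes from independence: if \<open>?K y - ?K x\<close> lies in
          \<open>U\<close>, then \<open>y\<close> and \<open>x\<close> differ by elements of
          \<open>W\<close> in every coordinate.\<close>
        obtain U where U: "open U" "0 \<in> U" "\<forall>x\<in>?D. ?K x \<in> U \<longrightarrow> (\<forall>a\<in>A. x a \<in> W)"
          using ind'[OF FW(3,4)] by blast
        let ?N = "?K ` ?D \<inter> (\<lambda>w. w - ?K x) -` U"
        have "open ((\<lambda>w. w - ?K x) -` U)" by (intro open_vimage U(1) continuous_intros)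
        then have "openin (top_of_set (?K ` ?D)) ?N" by (rule openin_open_Int)
        moreover have "p \<in> ?N" using x xD U(2) by simp
        moreover have "?K y \<in> ?K ` O'" if y: "y \<in> ?D" "?K y - ?K x \<in> U" for y
        proof -
          have "\<forall>a\<in>A. (\<lambda>a\<in>A. y a - x a) a \<in> W"
            using U(3) direct_sum_diff[OF y(1) xD] y(2) by metis
          then have "\<forall>a\<in>F. y a - x a \<in> W" using FW(2) by auto
          then have "y \<in> O'" using FW(5) y(1) by blast
          then show ?thesis by blast
        qed
        then have "?N \<subseteq> ?K ` O'" by auto
        ultimately show "\<exists>T. openin (top_of_set (?K ` ?D)) T \<and> p \<in> T \<and> T \<subseteq> ?K ` O'" by blast
      qed
    qed
    show "?K ` topspace ?T = topspace (top_of_set (?K ` ?D))"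
      by (simp add: topspace_direct_sum_topology)
    show "inj_on ?K (topspace ?T)" using inj by (simp add: topspace_direct_sum_topology)
  qed
  then have "embedding_map ?T euclidean ?K"
    by (simp add: embedding_map_def topspace_direct_sum_topology)
  then show ?thesis
    unfolding tychonoff_direct_sum_def using inj direct_sum_map_add by blast
qed

text \<open>Continuity of the summation map at 0 puts \<open><a>\<close> into \<open>W\<close> for
  all \<open>a\<close> outside a finite set \<open>F\<close>; openness onto the image controls the
  coordinates in \<open>F\<close>.\<close>

lemma tychonoff_direct_sum_imp_independent:
  fixes A :: "'a::{topological_ab_group_add, t2_space} set"
  assumes "0 \<notin> A" and tds: "tychonoff_direct_sum A"
  shows "topologically_independent A"
  unfolding topologically_independent_iff[OF assms(1)]
proof (intro allI impI)
  let ?K = "direct_sum_map A" and ?D = "direct_sum A" and ?T = "direct_sum_topology A"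
  fix W :: "'a set" assume W: "open W" "0 \<in> W"
  have inj: "inj_on ?K ?D" and hom: "homeomorphic_map ?T (top_of_set (?K ` ?D)) ?K"
    using tds by (auto simp: tychonoff_direct_sum_def embedding_map_def topspace_direct_sum_topology)
  define o' :: "'a \<Rightarrow> 'a" where "o' = (\<lambda>a\<in>A. 0)"
  have o': "o' \<in> ?D" "?K o' = 0"
    using direct_sum_family[of "{}" A] by (simp_all add: o'_def)
  have "continuous_map ?T euclidean ?K"
    using homeomorphic_imp_continuous_map[OF hom] by (rule continuous_map_into_fulltopology)
  then have "openin ?T {x \<in> ?D. ?K x \<in> W}"
    using openin_continuous_map_preimage[of ?T euclidean ?K W] W(1) by (simp add: topspace_direct_sum_topology)
  moreover have "o' \<in> {x \<in> ?D. ?K x \<in> W}" using o' W(2) by simp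
  ultimately obtain F V where FV: "finite F" "F \<subseteq> A" "open V" "0 \<in> V"
    "\<forall>y\<in>?D. (\<forall>a\<in>F. y a - o' a \<in> V) \<longrightarrow> y \<in> {x \<in> ?D. ?K x \<in> W}"
    by (rule openin_direct_sum_topologyE) (rule that; assumption)
  have small: "zmul k a \<in> W" if a: "a \<in> A - F" for k a
  proof -
    \<comment> \<open>An element supported at \<open>a\<close> vanishes on \<open>F\<close> and so
      meets the conditions there for every \<open>k\<close>.\<close>
    define y where "y = (\<lambda>b\<in>A. if b \<in> {a} then zmul k b else 0)"
    have y: "y \<in> ?D" "?K y = zmul k a"
      using direct_sum_family[of "{a}" A "\<lambda>_. k"] a by (simp_all add: y_def)
    have "\<forall>b\<in>F. y b - o' b \<in> V"
      using a FV(2,4) by (auto simp: y_def o'_def)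
    then have "y \<in> {x \<in> ?D. ?K x \<in> W}" using FV(5) y(1) by blast
    then show ?thesis using y by simp
  qed
  \<comment> \<open>The image of this set is a relative neighbourhood of 0; injectivity then brings
    the condition on \<open>F\<close> back from the image to \<open>x\<close>.\<close>
  let ?N = "{y \<in> ?D. \<forall>a\<in>F. y a - o' a \<in> W}"
  have "openin (top_of_set (?K ` ?D)) (?K ` ?N)"
    using homeomorphic_imp_open_map[OF hom] openin_direct_sum_basic[OF FV(1,2) W(1) o'(1)]
    by (simp add: open_map_def)
  then obtain U where U: "open U" "?K ` ?N = ?K ` ?D \<inter> U" by (auto simp: openin_open)
  have "o' \<in> ?N" using o' W(2) by simp
  then have "0 \<in> U" using U(2) o'(2) by (metis (no_types, lifting) IntD2 imageI)
  moreover have "x a \<in> W" if x: "x \<in> ?D" "?K x \<in> U" and a: "a \<in> A" for x a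
  proof (cases "a \<in> F")
    case True
    have "?K x \<in> ?K ` ?N" using U(2) x by blast
    then have "x \<in> ?N" using inj x(1) unfolding inj_on_def by blast
    then have "x a - o' a \<in> W" using True by blast
    then show ?thesis using a by (simp add: o'_def)
  next
    case False
    obtain z where "x a = zmul z a" using direct_sum_coord[OF x(1) a] by blast
    then show ?thesis using small a False by simp
  qed
  ultimately show "\<exists>U. open U \<and> 0 \<in> U \<and> (\<forall>x\<in>?D. ?K x \<in> U \<longrightarrow> (\<forall>a\<in>A. x a \<in> W))"
    using U(1) by blast
qed

theorem theorem1p1:
  fixes A :: "'a::{topological_ab_group_add, t2_space} set"
  assumes "precompact_in TYPE('k::{topological_ab_group_add, t2_space}) TYPE('a)"
    and "0 \<notin> A"
  shows "topologically_independent A \<longleftrightarrow> tychonoff_direct_sum A"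
  using independent_imp_tychonoff_direct_sum[OF assms(1)] tychonoff_direct_sum_imp_independent[OF assms(2)]
  by blast

end
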